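(* Let $\beta=2/\log(e/2)$ and consider the continuous random graph process $(\mathcal G_p)_{0\le p\le1}$ on $[n]$. Let $w(n)\to\infty$ be any function. Then a.a.s.: (i) for all $p\le\frac{\beta(\log n-\frac12\log\log n)-w(n)}{n-1}$, $\delta(\mathcal G_p)\le\bar d(\mathcal G_p)/2$; and (ii) for all $p\ge\frac{\beta(\log n-\frac12\log\log n)+w(n)}{n-1}$, $\delta(\mathcal G_p)>\bar d(\mathcal G_p)/2$. Moreover, for every constant $0<\theta<1$ there is a constant $\rho>0$ such that a.a.s. (iii) for all $\rho\log n/(n-1)\le p\le1$, $\delta(\mathcal G_p)>\theta\,\bar d(\mathcal G_p)$.
   Context: The continuous random graph process: to each edge $e$ of the complete graph on $[n]$ associate an independent random variable $P_e$ uniform on $[0,1]$, and for $p\in[0,1]$ let $\mathcal G_p$ be the graph on $[n]$ whose edges are those $e$ with $P_e\le p$ (so $\mathcal G_p$ is distributed as the Erdős–Rényi graph $\mathcal G(n,p)$). For a graph $G$ on $n$ vertices, $\delta(G)$ is the minimum degree and $\bar d(G)=2m(G)/(n-1)$, $m(G)$ being the number of edges. "A.a.s." means with probability tending to $1$ as $n\to\infty$; the statements are required to hold simultaneously for all $p$ in the given ranges. *)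

theory Defs
  imports "HOL-Probability.Probability"
begin

definition kn_edges :: "nat \<Rightarrow> (nat \<times> nat) set" where
  "kn_edges n = {(i, j). i < j \<and> j < n}"

definition graph_process :: "nat \<Rightarrow> ((nat \<times> nat) \<Rightarrow> real) measure" where
  "graph_process n = PiM (kn_edges n) (\<lambda>_. uniform_measure lborel {0..1::real})"

definition gp_edges :: "nat \<Rightarrow> ((nat \<times> nat) \<Rightarrow> real) \<Rightarrow> real \<Rightarrow> nat" where
  "gp_edges n P p = card {e \<in> kn_edges n. P e \<le> p}"

definition gp_degree :: "nat \<Rightarrow> ((nat \<times> nat) \<Rightarrow> real) \<Rightarrow> real \<Rightarrow> nat \<Rightarrow> nat" where
  "gp_degree n P p v = card {u. u < n \<and> u \<noteq> v \<and> P (min u v, max u v) \<le> p}"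

definition gp_mindeg :: "nat \<Rightarrow> ((nat \<times> nat) \<Rightarrow> real) \<Rightarrow> real \<Rightarrow> nat" where
  "gp_mindeg n P p = Min (gp_degree n P p ` {..<n})"

text \<open>Normalised average degree 2 m(G_p) / (n - 1).\<close>
definition gp_avgdeg :: "nat \<Rightarrow> ((nat \<times> nat) \<Rightarrow> real) \<Rightarrow> real \<Rightarrow> real" where
  "gp_avgdeg n P p = 2 * real (gp_edges n P p) / (real n - 1)"

end

theory Submission
  imports Defs "HOL-Real_Asymp.Real_Asymp"
begin

text \<open>
  Put \<open>N = n - 1\<close> and \<open>x = N p\<close>. A degree is binomial with mean \<open>x\<close>, while half the average degree
  is \<open>m / N\<close>, which stays within \<open>O(1)\<close> of \<open>x / 2\<close>; the expected number of vertices of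
  degree about \<open>x / 2\<close> is of order \<open>n exp (- x / \<beta>) / sqrt x\<close>, and \<open>x = \<beta> (ln n - ln (ln n) / 2)\<close> is
  where this has constant order. Degrees and edge counts increase with \<open>p\<close>, so it suffices to control them at the
  points \<open>p = i / N\<close> with \<open>i\<close> an integer: between two neighbouring ones the mean changes by \<open>1\<close>, which
  costs only a constant factor. The failure probabilities at these points (second moment below the
  threshold, first moment above it) are geometric in \<open>i\<close> and sum to a multiple of \<open>exp (- w / \<beta>)\<close>. For
  \<open>x \<ge> \<rho> ln n\<close>, Chernoff's bound for the degrees and Chebyshev's for \<open>m\<close> suffice.
\<close>

section \<open>Open edges as independent trials\<close>

text \<open>The constant comes from Stirling's formula: at \<open>k = x / 2\<close> the Poisson
  probability \<open>exp (- x) * x ^ k / fact k\<close> is of order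
  \<open>exp (- x) * (2 * exp 1) ^ k / sqrt k\<close>, hence of order
  \<open>exp (- (1 - ln 2) / 2 * x) / sqrt x\<close>. Since \<open>w\<close> may grow arbitrarily
  slowly, estimates near the threshold must be sharp up to constant factors. An additive error O(1)
  in a degree costs only such a factor, so \<open>m\<close> may deviate by \<open>N / 2\<close>;
  Chebyshev's failure bound for this is of order \<open>i / N\<close>, small enough to be summed
  over O(ln n) grid points. The second moment is taken for vertices of one exact degree
  \<open>k\<close>: two vertices share a single potential edge, and given its state their degrees
  are independent, so the covariance can be written down exactly. Inside a grid cell the degree is
  read at one end and \<open>m\<close> at the other, as monotonicity dictates; small integer offsets
  around \<open>i / 2\<close> pay for the difference. As \<open>measure\<close> is 0 on sets that
  are not measurable, events that quantify over uncountably many \<open>p\<close> need a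
  measurability proof of their own.\<close>

definition open_edges :: "(nat \<times> nat) set \<Rightarrow> ((nat \<times> nat) \<Rightarrow> real) \<Rightarrow> real \<Rightarrow> (nat \<times> nat) set" where
  "open_edges A P p = {e \<in> A. P e \<le> p}"

lemma finite_kn_edges [simp]: "finite (kn_edges n)"
  by (rule finite_subset[of _ "{..<n} \<times> {..<n}"]) (auto simp: kn_edges_def)

lemma prob_space_uniform01: "prob_space (uniform_measure lborel {0..1::real})"
  by (rule prob_space_uniform_measure) auto

lemma prob_space_graph_process: "prob_space (graph_process n)"
  unfolding graph_process_def by (intro prob_space_PiM prob_space_uniform01)

text \<open>The event is a cylinder over \<open>A\<close>: labels in \<open>{..p}\<close> on
  \<open>S\<close> and in \<open>{p<..}\<close> on the rest of \<open>A\<close>. The product measure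
  is evaluated only here; later probabilities are finite sums over such atoms.\<close>

lemma open_edges_eq_prob:
  assumes A: "A \<subseteq> kn_edges n" and S: "S \<subseteq> A" and p: "0 \<le> p" "p \<le> 1"
  shows "{P \<in> space (graph_process n). open_edges A P p = S} \<in> sets (graph_process n)"
    and "measure (graph_process n) {P \<in> space (graph_process n). open_edges A P p = S} =
      p ^ card S * (1 - p) ^ (card A - card S)"
proof -
  let ?U = "uniform_measure lborel {0..1::real}"
  interpret product_prob_space "\<lambda>_. ?U" "kn_edges n"
    by unfold_locales (rule prob_space_uniform01 prob_space.emeasure_space_1
        prob_space_imp_sigma_finite sigma_finite_measure.sigma_finite_countable
        finite_measure.finite_emeasure_space prob_space.finite_measure)+
  have finA: "finite A" using A finite_subset finite_kn_edges by blast
  let ?X = "\<lambda>e. if e \<in> S then {..p} else {p<..}"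
  have eq: "{P \<in> space (graph_process n). open_edges A P p = S} =
      prod_emb (kn_edges n) (\<lambda>_. ?U) A (Pi\<^sub>E A ?X)"
    using A S unfolding graph_process_def open_edges_def prod_emb_def space_PiM
    by (fastforce simp: PiE_iff restrict_def extensional_def split: if_splits)
  have X: "?X e \<in> sets ?U" for e by simp
  show "{P \<in> space (graph_process n). open_edges A P p = S} \<in> sets (graph_process n)"
    unfolding eq unfolding graph_process_def using A finA X by (intro sets_PiM_I) auto
  have m1: "measure ?U {..p} = p"
  proof -
    have "{0..1} \<inter> {..p} = {0..p}" using p by auto
    then show ?thesis using p by simp
  qed
  have m2: "measure ?U {p<..} = 1 - p"
  proof -
    have "{0..1} \<inter> {p<..} = {p<..1}" using p by auto
    then show ?thesis using p by simp
  qed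
  have "measure (graph_process n) {P \<in> space (graph_process n). open_edges A P p = S} =
      (\<Prod>e\<in>A. measure ?U (?X e))"
    unfolding eq unfolding graph_process_def using A finA X by (intro measure_PiM_emb) auto
  also have "\<dots> = (\<Prod>e\<in>A. if e \<in> S then p else 1 - p)"
    by (intro prod.cong refl) (simp only: m1 m2 split: if_split, blast)
  also have "\<dots> = p ^ card (A \<inter> {e. e \<in> S}) * (1 - p) ^ card (A \<inter> - {e. e \<in> S})"
    using finA by (simp add: prod.If_cases)
  also have "A \<inter> {e. e \<in> S} = S" using S by auto
  also have "A \<inter> - {e. e \<in> S} = A - S" by auto
  also have "card (A - S) = card A - card S" using S finA by (meson card_Diff_subset finite_subset)
  finally show "measure (graph_process n) {P \<in> space (graph_process n). open_edges A P p = S} =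
      p ^ card S * (1 - p) ^ (card A - card S)" .
qed

text \<open>\<open>A\<close> has finitely many subsets, so the event is a finite disjoint union of
  atoms. Hence \<open>Q\<close> may be arbitrary, and measurability at a fixed time is
  automatic.\<close>

lemma open_edges_prob:
  assumes A: "A \<subseteq> kn_edges n" and p: "0 \<le> p" "p \<le> 1"
  shows "{P \<in> space (graph_process n). Q (open_edges A P p)} \<in> sets (graph_process n)"
    and "measure (graph_process n) {P \<in> space (graph_process n). Q (open_edges A P p)} =
      (\<Sum>S | S \<subseteq> A \<and> Q S. p ^ card S * (1 - p) ^ (card A - card S))"
proof -
  interpret prob_space "graph_process n" by (rule prob_space_graph_process)
  have finA: "finite A" using A finite_subset finite_kn_edges by blast
  let ?E = "\<lambda>S. {P \<in> space (graph_process n). open_edges A P p = S}"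
  have eq: "{P \<in> space (graph_process n). Q (open_edges A P p)} = (\<Union>S\<in>{S. S \<subseteq> A \<and> Q S}. ?E S)"
    by (auto simp: open_edges_def)
  have fin: "finite {S. S \<subseteq> A \<and> Q S}" using finA by auto
  show "{P \<in> space (graph_process n). Q (open_edges A P p)} \<in> sets (graph_process n)"
    unfolding eq by (rule sets.finite_UN[OF fin]) (use open_edges_eq_prob(1)[OF A _ p] in auto)
  have "measure (graph_process n) (\<Union>S\<in>{S. S \<subseteq> A \<and> Q S}. ?E S) =
      (\<Sum>S | S \<subseteq> A \<and> Q S. measure (graph_process n) (?E S))"
    by (rule finite_measure_finite_Union[OF fin])
      (use open_edges_eq_prob(1)[OF A _ p] in \<open>auto simp: disjoint_family_on_def\<close>)
  also have "\<dots> = (\<Sum>S | S \<subseteq> A \<and> Q S. p ^ card S * (1 - p) ^ (card A - card S))"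
    by (rule sum.cong) (use open_edges_eq_prob(2)[OF A _ p] in auto)
  finally show "measure (graph_process n) {P \<in> space (graph_process n). Q (open_edges A P p)} =
      (\<Sum>S | S \<subseteq> A \<and> Q S. p ^ card S * (1 - p) ^ (card A - card S))" using eq by simp
qed

text \<open>Sending \<open>S\<close> to \<open>(S \<inter> A, S \<inter> B)\<close> is a bijection
  under which the weights multiply, so the sum over subsets of \<open>A \<union> B\<close>
  factors.\<close>

lemma open_edges_indep:
  assumes A: "A \<subseteq> kn_edges n" and B: "B \<subseteq> kn_edges n" and AB: "A \<inter> B = {}" and p: "0 \<le> p" "p \<le> 1"
  shows "measure (graph_process n) {P \<in> space (graph_process n). Q (open_edges A P p) \<and> R (open_edges B P p)} =
     measure (graph_process n) {P \<in> space (graph_process n). Q (open_edges A P p)} *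
     measure (graph_process n) {P \<in> space (graph_process n). R (open_edges B P p)}"
proof -
  have fin: "finite A" "finite B" using A B finite_subset finite_kn_edges by blast+
  let ?w = "\<lambda>A S. p ^ card S * (1 - p) ^ (card A - card S)"
  have oe: "open_edges (A \<union> B) P p \<inter> A = open_edges A P p" "open_edges (A \<union> B) P p \<inter> B = open_edges B P p" for P
    by (auto simp: open_edges_def)
  have "measure (graph_process n) {P \<in> space (graph_process n). Q (open_edges A P p) \<and> R (open_edges B P p)} =
      (\<Sum>S | S \<subseteq> A \<union> B \<and> Q (S \<inter> A) \<and> R (S \<inter> B). ?w (A \<union> B) S)"
    using open_edges_prob(2)[of "A \<union> B" n p "\<lambda>S. Q (S \<inter> A) \<and> R (S \<inter> B)"] A B p by (simp add: oe)
  also have "\<dots> = (\<Sum>(S, T) \<in> {S. S \<subseteq> A \<and> Q S} \<times> {T. T \<subseteq> B \<and> R T}. ?w A S * ?w B T)"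
  proof (rule sum.reindex_bij_witness[where i = "\<lambda>(S, T). S \<union> T" and j = "\<lambda>S. (S \<inter> A, S \<inter> B)"])
    fix S assume S: "S \<in> {S. S \<subseteq> A \<union> B \<and> Q (S \<inter> A) \<and> R (S \<inter> B)}"
    show "(case (S \<inter> A, S \<inter> B) of (S, T) \<Rightarrow> S \<union> T) = S" using S by auto
    show "(S \<inter> A, S \<inter> B) \<in> {S. S \<subseteq> A \<and> Q S} \<times> {T. T \<subseteq> B \<and> R T}" using S by auto
    have "S = (S \<inter> A) \<union> (S \<inter> B)" using S by auto
    moreover have "card ((S \<inter> A) \<union> (S \<inter> B)) = card (S \<inter> A) + card (S \<inter> B)"
      using fin AB by (intro card_Un_disjoint) auto
    ultimately have c: "card S = card (S \<inter> A) + card (S \<inter> B)" by simp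
    have cAB: "card (A \<union> B) = card A + card B" using fin AB by (intro card_Un_disjoint) auto
    have le: "card (S \<inter> A) \<le> card A" "card (S \<inter> B) \<le> card B" using fin by (auto intro: card_mono)
    have "card A + card B - (card (S \<inter> A) + card (S \<inter> B)) = (card A - card (S \<inter> A)) + (card B - card (S \<inter> B))"
      using le by simp
    then show "(case (S \<inter> A, S \<inter> B) of (S, T) \<Rightarrow> ?w A S * ?w B T) = ?w (A \<union> B) S"
      by (simp add: c cAB power_add)
  next
    fix x assume "x \<in> {S. S \<subseteq> A \<and> Q S} \<times> {T. T \<subseteq> B \<and> R T}"
    then obtain S T where x: "x = (S, T)" "S \<subseteq> A" "Q S" "T \<subseteq> B" "R T" by auto
    have i: "(S \<union> T) \<inter> A = S" "(S \<union> T) \<inter> B = T" using x AB by auto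
    show "(\<lambda>S. (S \<inter> A, S \<inter> B)) (case x of (S, T) \<Rightarrow> S \<union> T) = x" by (simp add: x i)
    show "(case x of (S, T) \<Rightarrow> S \<union> T) \<in> {S. S \<subseteq> A \<union> B \<and> Q (S \<inter> A) \<and> R (S \<inter> B)}"
      using x by (auto simp: i)
  qed
  also have "\<dots> = (\<Sum>S | S \<subseteq> A \<and> Q S. ?w A S) * (\<Sum>T | T \<subseteq> B \<and> R T. ?w B T)"
    by (simp add: sum_product sum.cartesian_product)
  finally show ?thesis using open_edges_prob(2)[OF A p] open_edges_prob(2)[OF B p] by simp
qed

text \<open>Subsets of \<open>A\<close> are grouped by size. The library's Bernstein polynomial is
  the binomial point probability, which makes its known moment sums available.\<close>

lemma open_edges_card_prob:
  assumes A: "A \<subseteq> kn_edges n" and p: "0 \<le> p" "p \<le> 1"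
  shows "measure (graph_process n) {P \<in> space (graph_process n). R (card (open_edges A P p))} =
      (\<Sum>k | k \<le> card A \<and> R k. Bernstein (card A) k p)"
proof -
  have finA: "finite A" using A finite_subset finite_kn_edges by blast
  let ?w = "\<lambda>S. p ^ card S * (1 - p) ^ (card A - card S)"
  have "measure (graph_process n) {P \<in> space (graph_process n). R (card (open_edges A P p))} =
      (\<Sum>S | S \<subseteq> A \<and> R (card S). ?w S)"
    by (rule open_edges_prob(2)[OF A p])
  also have "\<dots> = (\<Sum>k | k \<le> card A \<and> R k. \<Sum>S | S \<in> {S. S \<subseteq> A \<and> R (card S)} \<and> card S = k. ?w S)"
    by (rule sum.group[symmetric]) (use finA in \<open>auto intro: card_mono\<close>)
  also have "\<dots> = (\<Sum>k | k \<le> card A \<and> R k. Bernstein (card A) k p)"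
  proof (rule sum.cong[OF refl])
    fix k assume "k \<in> {k. k \<le> card A \<and> R k}"
    then have "{S \<in> {S. S \<subseteq> A \<and> R (card S)}. card S = k} = {S. S \<subseteq> A \<and> card S = k}" by auto
    then have "(\<Sum>S | S \<in> {S. S \<subseteq> A \<and> R (card S)} \<and> card S = k. ?w S) =
        (\<Sum>S | S \<subseteq> A \<and> card S = k. p ^ k * (1 - p) ^ (card A - k))" by (intro sum.cong) auto
    also have "\<dots> = Bernstein (card A) k p"
      using n_subsets[OF finA, of k] by (simp add: Bernstein_def)
    finally show "(\<Sum>S | S \<in> {S. S \<subseteq> A \<and> R (card S)} \<and> card S = k. ?w S) = Bernstein (card A) k p" .
  qed
  finally show ?thesis .
qed

lemma open_edges_card_eq_prob:
  assumes A: "A \<subseteq> kn_edges n" and p: "0 \<le> p" "p \<le> 1"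
  shows "measure (graph_process n) {P \<in> space (graph_process n). card (open_edges A P p) = k} =
      Bernstein (card A) k p"
proof -
  have "{j. j \<le> card A \<and> j = k} = (if k \<le> card A then {k} else {})" by auto
  then show ?thesis using open_edges_card_prob[OF A p, of "\<lambda>j. j = k"] by (auto simp: Bernstein_def)
qed

lemma open_edges_chebyshev:
  assumes A: "A \<subseteq> kn_edges n" and p: "0 \<le> p" "p \<le> 1" and t: "t > 0"
  shows "measure (graph_process n) {P \<in> space (graph_process n).
      \<bar>real (card (open_edges A P p)) - real (card A) * p\<bar> \<ge> t} \<le> real (card A) * p / t\<^sup>2"
proof -
  let ?N = "card A"
  \<comment> \<open>The square is expanded in the factorial moments \<open>a * (a - 1)\<close>,
    \<open>a\<close> and 1, whose Bernstein sums are known.\<close>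
  have *: "\<And>a b x::real. (a - b)\<^sup>2 * x = a * (a - 1) * x + (1 - 2 * b) * (a * x) + b * b * x"
    by (simp add: algebra_simps power2_eq_square)
  have var: "(\<Sum>k\<le>?N. (real k - ?N * p)\<^sup>2 * Bernstein ?N k p) = ?N * p * (1 - p)"
    unfolding * sum.distrib
    by (simp flip: sum_distrib_left) (simp add: algebra_simps power2_eq_square)
  have "measure (graph_process n) {P \<in> space (graph_process n).
      \<bar>real (card (open_edges A P p)) - real (card A) * p\<bar> \<ge> t} =
      (\<Sum>k | k \<le> ?N \<and> \<bar>real k - ?N * p\<bar> \<ge> t. Bernstein ?N k p)"
    by (rule open_edges_card_prob[OF A p, of "\<lambda>k. \<bar>real k - ?N * p\<bar> \<ge> t"])
  also have "\<dots> \<le> (\<Sum>k | k \<le> ?N \<and> \<bar>real k - ?N * p\<bar> \<ge> t. (real k - ?N * p)\<^sup>2 * Bernstein ?N k p / t\<^sup>2)"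
  proof (rule sum_mono)
    fix k assume "k \<in> {k. k \<le> ?N \<and> \<bar>real k - ?N * p\<bar> \<ge> t}"
    then have "t\<^sup>2 \<le> (real k - ?N * p)\<^sup>2" using t by (simp add: abs_le_square_iff[symmetric])
    then have "t\<^sup>2 * Bernstein ?N k p \<le> (real k - ?N * p)\<^sup>2 * Bernstein ?N k p"
      using Bernstein_nonneg[OF p] by (rule mult_right_mono)
    then show "Bernstein ?N k p \<le> (real k - ?N * p)\<^sup>2 * Bernstein ?N k p / t\<^sup>2"
      using t by (simp add: field_simps)
  qed
  also have "\<dots> \<le> (\<Sum>k\<le>?N. (real k - ?N * p)\<^sup>2 * Bernstein ?N k p / t\<^sup>2)"
    using Bernstein_nonneg[OF p] by (intro sum_mono2) auto
  also have "\<dots> = ?N * p * (1 - p) / t\<^sup>2" by (simp add: var flip: sum_divide_distrib)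
  also have "\<dots> \<le> ?N * p / t\<^sup>2"
    using p t by (intro divide_right_mono mult_left_le) auto
  finally show ?thesis .
qed

section \<open>The second moment method\<close>

text \<open>Chebyshev's inequality for the number of events that occur: off the union this number is
  0, at squared distance \<open>\<mu>\<^sup>2\<close> from its mean, while its variance is at most
  \<open>\<mu> + d * \<mu>\<^sup>2\<close>. The parameter \<open>d\<close> bounds the relative
  excess of pair probabilities over independence.\<close>

lemma (in prob_space) second_moment_none:
  assumes V: "finite V" "V \<noteq> {}" and ev: "\<And>v. v \<in> V \<Longrightarrow> E v \<in> events"
    and q: "\<And>v. v \<in> V \<Longrightarrow> prob (E v) = q" and q0: "q > 0"
    and pair: "\<And>u v. u \<in> V \<Longrightarrow> v \<in> V \<Longrightarrow> u \<noteq> v \<Longrightarrow> prob (E u \<inter> E v) \<le> (1 + d) * q\<^sup>2" and d: "d \<ge> 0"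
  shows "prob (space M - (\<Union>v\<in>V. E v)) \<le> 1 / (real (card V) * q) + d"
proof -
  let ?X = "\<lambda>x. \<Sum>v\<in>V. indicator (E v) x :: real"
  define \<mu> where "\<mu> = real (card V) * q"
  have mu: "\<mu> > 0" using V q0 by (simp add: \<mu>_def card_gt_0_iff)
  have [measurable]: "E v \<in> events" if "v \<in> V" for v using ev that .
  have int[simp]: "integrable M (\<lambda>x. indicator (E v) x :: real)" if "v \<in> V" for v
    using that ev by (simp add: integrable_indicator_iff less_top[symmetric])
  have int2: "integrable M (\<lambda>x. indicator (E u \<inter> E v) x :: real)" if "u \<in> V" "v \<in> V" for u v
    using that ev by (simp add: integrable_indicator_iff less_top[symmetric] sets.Int)
  let ?N = "space M - (\<Union>v\<in>V. E v)"
  have Nev: "?N \<in> events" using V ev by (intro sets.Diff sets.top sets.finite_UN) auto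
  have sq: "(?X x - \<mu>)\<^sup>2 = (\<Sum>u\<in>V. \<Sum>v\<in>V. indicator (E u \<inter> E v) x) - 2 * \<mu> * ?X x + \<mu>\<^sup>2" for x
  proof -
    have "?X x * ?X x = (\<Sum>u\<in>V. \<Sum>v\<in>V. indicator (E u \<inter> E v) x)"
      by (simp add: sum_product indicator_inter_arith)
    then show ?thesis by (simp only: power2_eq_square left_diff_distrib right_diff_distrib) simp
  qed
  have ints: "integrable M (\<lambda>x. (?X x - \<mu>)\<^sup>2)"
    unfolding sq by (intro Bochner_Integration.integrable_add Bochner_Integration.integrable_diff
        Bochner_Integration.integrable_sum integrable_mult_right int int2) auto
  have intg: "(LINT x|M. (?X x - \<mu>)\<^sup>2) = (\<Sum>u\<in>V. \<Sum>v\<in>V. prob (E u \<inter> E v)) - \<mu>\<^sup>2"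
  proof -
    have i1: "integrable M (\<lambda>x. \<Sum>u\<in>V. \<Sum>v\<in>V. indicator (E u \<inter> E v) x :: real)"
      and i2: "integrable M (\<lambda>x. 2 * \<mu> * ?X x)"
      by (intro Bochner_Integration.integrable_sum integrable_mult_right int int2; assumption)+
    have "(LINT x|M. (?X x - \<mu>)\<^sup>2) = (LINT x|M. (\<Sum>u\<in>V. \<Sum>v\<in>V. indicator (E u \<inter> E v) x)) -
       (LINT x|M. 2 * \<mu> * ?X x) + (LINT x|M. \<mu>\<^sup>2)"
      unfolding sq using Bochner_Integration.integral_add[OF Bochner_Integration.integrable_diff[OF i1 i2], of "\<lambda>_. \<mu>\<^sup>2"]
        Bochner_Integration.integral_diff[OF i1 i2] by simp
    also have "(LINT x|M. (\<Sum>u\<in>V. \<Sum>v\<in>V. indicator (E u \<inter> E v) x :: real)) = (\<Sum>u\<in>V. \<Sum>v\<in>V. prob (E u \<inter> E v))"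
    proof -
      have "(LINT x|M. (\<Sum>v\<in>V. indicator (E u \<inter> E v) x :: real)) = (\<Sum>v\<in>V. prob (E u \<inter> E v))" if u: "u \<in> V" for u
        using u ev int2 by (subst Bochner_Integration.integral_sum) (auto intro!: sum.cong simp: sets.Int sets.sets_into_space Int_absorb2)
      then show ?thesis
        by (subst Bochner_Integration.integral_sum) (auto intro!: Bochner_Integration.integrable_sum int2)
    qed
    also have "(LINT x|M. 2 * \<mu> * ?X x) = 2 * \<mu> * \<mu>"
    proof -
      have "(LINT x|M. ?X x) = (\<Sum>v\<in>V. prob (E v))"
        using ev int by (subst Bochner_Integration.integral_sum) (auto intro!: sum.cong simp: sets.sets_into_space Int_absorb2)
      then show ?thesis using q by (simp add: \<mu>_def)
    qed
    finally show ?thesis by (simp add: prob_space power2_eq_square)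
  qed
  have "\<mu>\<^sup>2 * prob ?N = (LINT x|M. \<mu>\<^sup>2 * indicator ?N x)"
    using Nev by simp
  also have "\<dots> \<le> (LINT x|M. (?X x - \<mu>)\<^sup>2)"
  proof (rule integral_mono)
    show "integrable M (\<lambda>x. \<mu>\<^sup>2 * indicator ?N x)"
      using Nev by (intro integrable_mult_right) (simp add: integrable_indicator_iff less_top[symmetric])
    show "integrable M (\<lambda>x. (?X x - \<mu>)\<^sup>2)" by (rule ints)
    fix x assume "x \<in> space M"
    show "\<mu>\<^sup>2 * indicator ?N x \<le> (?X x - \<mu>)\<^sup>2"
    proof (cases "x \<in> ?N")
      case True
      then have "?X x = 0" by (intro sum.neutral) auto
      then show ?thesis using True by simp
    next
      case False
      then show ?thesis by simp
    qed
  qed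
  also have "\<dots> \<le> \<mu> + d * \<mu>\<^sup>2"
  proof -
    have "(\<Sum>v\<in>V. prob (E u \<inter> E v)) \<le> q + real (card V) * ((1 + d) * q\<^sup>2)" if u: "u \<in> V" for u
    proof -
      have "(\<Sum>v\<in>V. prob (E u \<inter> E v)) = prob (E u \<inter> E u) + (\<Sum>v\<in>V - {u}. prob (E u \<inter> E v))"
        using V u by (subst sum.remove[of V u]) auto
      also have "prob (E u \<inter> E u) = q" using q u by simp
      also have "(\<Sum>v\<in>V - {u}. prob (E u \<inter> E v)) \<le> (\<Sum>v\<in>V - {u}. (1 + d) * q\<^sup>2)"
        using u pair by (intro sum_mono) auto
      also have "\<dots> \<le> (\<Sum>v\<in>V. (1 + d) * q\<^sup>2)" using V d by (intro sum_mono2) auto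
      finally show ?thesis by simp
    qed
    then have "(\<Sum>u\<in>V. \<Sum>v\<in>V. prob (E u \<inter> E v)) \<le> (\<Sum>u\<in>V. q + real (card V) * ((1 + d) * q\<^sup>2))"
      by (rule sum_mono)
    also have "\<dots> = \<mu> + (1 + d) * \<mu>\<^sup>2" by (simp add: \<mu>_def algebra_simps power2_eq_square)
    finally show ?thesis by (simp add: intg algebra_simps)
  qed
  finally have "prob ?N \<le> (\<mu> + d * \<mu>\<^sup>2) / \<mu>\<^sup>2" using mu by (simp add: field_simps)
  also have "\<dots> = 1 / \<mu> + d" using mu by (simp add: field_simps power2_eq_square)
  finally show ?thesis by (simp add: \<mu>_def)
qed

section \<open>Binomial tail estimates\<close>

text \<open>From \<open>k\<close> to \<open>k + 1\<close> the difference of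
  \<open>ln (fact k)\<close> and \<open>(k + 1/2) * ln k - k\<close> changes by
  \<open>1 - (k + 1/2) * (ln (k + 1) - ln k)\<close>. The midpoint and trapezoidal bounds for the
  integral of 1/t show that this is at most 0 and at least minus the decrease of
  \<open>1 / (4 * k)\<close>; that term makes the second induction telescope.\<close>

lemma ln_fact_bounds:
  assumes "k \<ge> 1"
  shows "ln (fact k) \<le> (real k + 1/2) * ln k - real k + 1"
    and "ln (fact k) \<ge> (real k + 1/2) * ln k - real k + 3/4 + 1 / (4 * real k)"
  using assms
proof (induction k rule: dec_induct)
  case base
  case 1 show ?case by simp
next
  case base
  case 2 show ?case by simp
next
  case (step k)
  have k: "k \<ge> 1" using step by simp
  have lf: "ln (fact (Suc k)) = ln (real k + 1) + ln (fact k)"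
    using k by (simp add: ln_mult add.commute)
  have "2 * 1 / (2 * real k + 1) \<le> ln (real k + 1) - ln (real k)"
    using ln_inverse_approx_ge[of "real k" "real k + 1"] k by simp
  then have a: "1 \<le> (real k + 1/2) * (ln (real k + 1) - ln (real k))"
    using k by (simp add: field_simps)
  have "ln (real k + 1) - ln (real k) \<le> (inverse (real k) + inverse (real k + 1)) / 2"
    using ln_inverse_approx_le[of "real k" 1] k by simp
  then have "(real k + 1/2) * (ln (real k + 1) - ln (real k)) \<le>
      (real k + 1/2) * ((inverse (real k) + inverse (real k + 1)) / 2)"
    by (intro mult_left_mono) auto
  also have "\<dots> = 1 + (1 / (4 * real k) - 1 / (4 * (real k + 1)))"
    using k by (simp add: divide_simps) (simp add: algebra_simps)
  finally have b: "(real k + 1/2) * (ln (real k + 1) - ln (real k)) \<le> 1 + (1 / (4 * real k) - 1 / (4 * (real k + 1)))" .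
  {
    case 1 
    show ?case using step.IH(1) a unfolding lf by (simp add: algebra_simps)
  next
    case 2
    show ?case using step.IH(2) b unfolding lf by (simp add: algebra_simps)
  }
qed

text \<open>Together with \<open>fact_lower\<close> this gives Stirling's order with the constants
  \<open>exp 1\<close> and 1 instead of the exact one; constant factors are harmless at the
  threshold.\<close>

lemma fact_upper:
  assumes "k \<ge> 1"
  shows "fact k \<le> exp 1 * sqrt k * (real k / exp 1) ^ k"
proof -
  have "fact k = exp (ln (fact k :: real))" by simp
  also have "\<dots> \<le> exp ((real k + 1/2) * ln k - real k + 1)"
    using ln_fact_bounds(1)[OF assms] by (simp only: exp_le_cancel_iff)
  also have "(real k + 1/2) * ln k - real k + 1 = 1 + ln (sqrt k) + real k * ln (real k / exp 1)"
    using assms by (simp add: ln_div ln_sqrt algebra_simps)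
  also have "exp \<dots> = exp 1 * sqrt k * (real k / exp 1) ^ k"
    using assms by (simp only: exp_add exp_of_nat_mult) simp
  finally show ?thesis .
qed

lemma fact_lower:
  assumes "k \<ge> 1"
  shows "sqrt k * (real k / exp 1) ^ k \<le> fact k"
proof -
  have "sqrt k * (real k / exp 1) ^ k = exp (ln (sqrt k) + real k * ln (real k / exp 1))"
    using assms by (simp only: exp_add exp_of_nat_mult) simp
  also have "ln (sqrt k) + real k * ln (real k / exp 1) = (real k + 1/2) * ln k - real k"
    using assms by (simp add: ln_div ln_sqrt algebra_simps)
  also have "\<dots> \<le> ln (fact k)"
    using ln_fact_bounds(2)[OF assms] assms by (smt (verit) divide_nonneg_nonneg of_nat_0_le_iff)
  finally show ?thesis by simp
qed

text \<open>A Poisson variable of mean \<open>x\<close> is at most \<open>x / 2\<close> with probability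
  of order \<open>exp (- rate * x) / sqrt x\<close>; hence \<open>rate = 1 / \<beta>\<close>.\<close>

definition rate :: real where "rate = (1 - ln 2) / 2"

lemma rate_pos: "rate > 0" and rate_less: "rate < 1/2"
  using ln2_le_25_over_36 by (auto simp: rate_def)

text \<open>With \<open>x\<close> near \<open>2 * k\<close>, Stirling's formula turns
  \<open>x ^ k / fact k\<close> into this power over a square root. The factor
  \<open>exp (- x)\<close> then produces \<open>rate\<close>, because
  \<open>1 - (1 + ln 2) / 2 = rate\<close>.\<close>

lemma two_e_power: "(2 * exp 1 :: real) ^ k = exp (real k * (1 + ln 2))"
proof -
  have "exp (real k * (1 + ln 2)) = exp (1 + ln 2 :: real) ^ k" by (simp add: exp_of_nat_mult)
  then show ?thesis by (simp add: exp_add mult.commute)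
qed

section \<open>Binomial probabilities against Poisson ones\<close>

text \<open>The right side is a falling factorial with \<open>k\<close> factors, each larger than
  \<open>N - k\<close>.\<close>

lemma binomial_mult_fact_ge:
  assumes "k \<le> N"
  shows "(real N - real k) ^ k \<le> real (N choose k) * fact k"
  using assms
proof (induction k)
  case (Suc k)
  have "(real N - real (Suc k)) ^ k \<le> (real N - real k) ^ k"
    using Suc.prems by (intro power_mono) auto
  also have "\<dots> \<le> real (N choose k) * fact k" using Suc by simp
  finally have 1: "(real N - real (Suc k)) ^ k \<le> real (N choose k) * fact k" .
  have "(real N - real (Suc k)) ^ Suc k = (real N - real (Suc k)) * (real N - real (Suc k)) ^ k" by simp
  also have "\<dots> \<le> (real N - real k) * (real (N choose k) * fact k)"
    using 1 Suc.prems by (intro mult_mono) auto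
  also have "\<dots> = real ((N choose k) * (N - k)) * fact k" using Suc.prems by (simp add: of_nat_diff)
  also have "(N choose k) * (N - k) = Suc k * (N choose Suc k)"
    using binomial_absorb_comp[of N k] binomial_absorption[of k N] by (simp only: mult.commute)
  finally show ?case by (simp add: algebra_simps)
qed simp

text \<open>The condition \<open>4 * x\<^sup>2 \<le> real N\<close> keeps the binomial law within
  constant factors of the Poisson law: it makes \<open>N * p\<^sup>2\<close> and
  \<open>k\<^sup>2 / N\<close> at most 1/4. The window \<open>x \<le> 2 * real k + 3\<close> leaves
  room for rounding \<open>x / 2\<close> down to an integer with a margin.\<close>

lemma Bernstein_lower:
  assumes N: "N \<ge> 1" and x: "x = real N * p" "0 < x" "4 * x\<^sup>2 \<le> real N" and p2: "p \<le> 1/2"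
    and k: "2 * real k \<le> x" "x \<le> 2 * real k + 3"
  shows "Bernstein N k p \<ge> exp (-7) * exp (- rate * x) / sqrt (real k + 1)"
proof -
  have p0: "0 < p" using x N by (simp add: zero_less_mult_iff)
  have kN: "real k * real k \<le> real N / 4 "
  proof -
    have "real k * real k \<le> x * x" using k by (intro mult_mono) auto
    then show ?thesis using x by (simp add: power2_eq_square)
  qed
  have kleN: "k \<le> N"
  proof (rule ccontr)
    assume "\<not> k \<le> N" then have "real N < real k" by simp
    then have "real N * 1 \<le> real k * real k" using N by (intro mult_mono) auto
    then show False using kN N by simp
  qed
  have e1: "exp (- x) * exp (- (1/2)) \<le> (1 - p) ^ N"
  proof -
    have "- p - 2 * p\<^sup>2 \<le> ln (1 - p)" using p0 p2 by (intro ln_one_minus_pos_lower_bound) auto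
    then have "real N * (- p - 2 * p\<^sup>2) \<le> real N * ln (1 - p)" by (intro mult_left_mono) auto
    moreover have "real N * p\<^sup>2 \<le> 1/4"
    proof -
      have "real N * (real N * p\<^sup>2) \<le> real N * (1/4)" using x by (simp add: power2_eq_square algebra_simps)
      then show ?thesis using N by (simp add: mult_le_cancel_left)
    qed
    ultimately have "- x - 1/2 \<le> real N * ln (1 - p)" using x by (simp add: algebra_simps)
    then have "exp (- x - 1/2) \<le> exp (real N * ln (1 - p))" by simp
    also have "\<dots> = (1 - p) ^ N" using p2 by (simp add: exp_of_nat_mult)
    finally show ?thesis by (simp flip: exp_add)
  qed
  have e2: "(1 - p) ^ N \<le> (1 - p) ^ (N - k)" using p0 p2 by (intro power_decreasing) auto
  \<comment> \<open>Bernoulli's inequality: replacing \<open>N\<close> by \<open>N - k\<close> in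
    each of \<open>k\<close> factors costs at most a factor 2, because \<open>k\<^sup>2\<close> is
    small against \<open>N\<close>.\<close>
  have e3: "x ^ k / 2 \<le> (real N - real k) ^ k * p ^ k"
  proof -
    have "1 + real k * (- (real k / real N)) \<le> (1 + (- (real k / real N))) ^ k"
      using kleN N by (intro Bernoulli_inequality) simp
    moreover have "real k * (real k / real N) \<le> 1/2" using kN N by (simp add: field_simps)
    ultimately have "1/2 \<le> (1 - real k / real N) ^ k" by simp
    then have "x ^ k * (1/2) \<le> x ^ k * (1 - real k / real N) ^ k" using x by (intro mult_left_mono) auto
    also have "\<dots> = ((real N - real k) * p) ^ k"
    proof -
      have "x * (1 - real k / real N) = (real N - real k) * p" using x N by (simp add: field_simps)
      then show ?thesis by (simp flip: power_mult_distrib)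
    qed
    finally show ?thesis by (simp add: power_mult_distrib)
  qed
  have e4: "exp (real k * (1 + ln 2)) / (exp 1 * sqrt (real k + 1)) \<le> x ^ k / fact k"
  proof (cases "k = 0")
    case False
    then have k1: "k \<ge> 1" by simp
    have "fact k \<le> exp 1 * sqrt k * (real k / exp 1) ^ k" by (rule fact_upper[OF k1])
    also have "\<dots> \<le> exp 1 * sqrt (real k + 1) * (real k / exp 1) ^ k"
      by (intro mult_right_mono mult_left_mono) auto
    finally have f: "fact k \<le> exp 1 * sqrt (real k + 1) * (real k / exp 1) ^ k" .
    have "exp (real k * (1 + ln 2)) / (exp 1 * sqrt (real k + 1)) =
        (2 * real k) ^ k / (exp 1 * sqrt (real k + 1) * (real k / exp 1) ^ k)"
      unfolding two_e_power[symmetric] using k1 by (simp add: power_mult_distrib power_divide field_simps)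
    also have "\<dots> \<le> x ^ k / fact k"
      using k f by (intro frac_le power_mono) auto
    finally show ?thesis .
  qed simp
  have "exp (-7) * exp (- rate * x) / sqrt (real k + 1) \<le>
      exp (real k * (1 + ln 2)) / (exp 1 * sqrt (real k + 1)) / 2 * (exp (- x) * exp (- (1/2)))"
  proof -
    \<comment> \<open>The losses in the exponent are \<open>3/2 * (1 + ln 2)\<close> from
      \<open>k \<ge> (x - 3) / 2\<close>, 1 from Stirling's formula, 1 for the factor 2 and 1/2 from
      \<open>(1 - p) ^ N\<close>; 7 exceeds their sum.\<close>
    have "-7 - rate * x \<le> real k * (1 + ln 2) - 1 - 1 - x - 1/2"
    proof -
      have "(x - 3) / 2 * (1 + ln 2) \<le> real k * (1 + ln 2)" using k by (intro mult_right_mono) auto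
      then show ?thesis using ln2_le_25_over_36 by (simp add: rate_def field_simps)
    qed
    then have "exp (-7 - rate * x) \<le> exp (real k * (1 + ln 2) - 1 - 1 - x - 1/2)" by simp
    also have "\<dots> = exp (real k * (1 + ln 2)) / exp 1 / exp 1 * (exp (- x) * exp (- (1/2)))"
      by (simp add: algebra_simps flip: exp_add exp_diff)
    also have "\<dots> \<le> exp (real k * (1 + ln 2)) / exp 1 / 2 * (exp (- x) * exp (- (1/2)))"
      using exp_ge_add_one_self[of 1] by (intro mult_right_mono divide_left_mono) auto
    finally have "exp (-7 - rate * x) / sqrt (real k + 1) \<le>
        exp (real k * (1 + ln 2)) / exp 1 / 2 * (exp (- x) * exp (- (1/2))) / sqrt (real k + 1)"
      by (rule divide_right_mono) simp
    then show ?thesis by (simp add: exp_diff exp_minus field_simps)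
  qed
  also have "\<dots> \<le> (x ^ k / fact k) / 2 * (1 - p) ^ (N - k)"
    using e1 e2 e4 x by (intro mult_mono divide_right_mono) auto
  also have "\<dots> = (x ^ k / 2) / fact k * (1 - p) ^ (N - k)" by simp
  also have "\<dots> \<le> (real (N choose k) * fact k * p ^ k) / fact k * (1 - p) ^ (N - k)"
    using e3 p0 p2 binomial_mult_fact_ge[OF kleN]
    by (intro mult_right_mono divide_right_mono order_trans[OF e3]) auto
  also have "\<dots> = Bernstein N k p" by (simp add: Bernstein_def)
  finally show ?thesis .
qed

text \<open>Up to \<open>3 * x / 4\<close> each term is at least 4/3 of its predecessor, so a
  geometric series of ratio 3/4 bounds the sum by 4 times the last term.\<close>

lemma poisson_sum_le:
  assumes "x > 0" "4 * real K \<le> 3 * x"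
  shows "(\<Sum>k\<le>K. x ^ k / fact k) \<le> 4 * (x ^ K / fact K)"
  using assms(2)
proof (induction K)
  case (Suc K)
  have "(\<Sum>k\<le>Suc K. x ^ k / fact k) \<le> 4 * (x ^ K / fact K) + x ^ Suc K / fact (Suc K)"
    using Suc by simp
  also have "4 * (x ^ K / fact K) = 4 * real (Suc K) / x * (x ^ Suc K / fact (Suc K))"
    using assms(1) by (simp add: field_simps del: of_nat_Suc)
  also have "\<dots> \<le> 3 * (x ^ Suc K / fact (Suc K))"
    using Suc.prems assms(1) by (intro mult_right_mono) (auto simp: field_simps)
  finally show ?case by linarith
qed simp

text \<open>The exponent contains the common bound \<open>K\<close> instead of \<open>k\<close>, so
  that this factor can be pulled out of a sum over \<open>k \<le> K\<close>.\<close>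

lemma Bernstein_le_poisson:
  assumes p: "0 \<le> p" "p \<le> 1" and k: "k \<le> K" "K \<le> N"
  shows "Bernstein N k p \<le> (real N * p) ^ k / fact k * exp (- real N * p + p * real K)"
proof -
  have "real (N choose k) \<le> real N ^ k / fact k"
  proof -
    have "real ((N choose k) * fact k) \<le> real (N ^ k)"
      using binomial_fact_pow[of N k] by (simp only: of_nat_le_iff)
    then show ?thesis by (simp add: le_divide_eq)
  qed
  then have 1: "real (N choose k) * p ^ k \<le> (real N * p) ^ k / fact k"
    using mult_right_mono[of "real (N choose k)" "real N ^ k / fact k" "p ^ k"] p by (simp add: power_mult_distrib)
  have "1 - p \<le> exp (- p)" using exp_ge_add_one_self[of "- p"] by simp
  then have "(1 - p) ^ (N - k) \<le> exp (- p) ^ (N - k)" using p by (intro power_mono) auto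
  also have "\<dots> \<le> exp (- p) ^ (N - K)" using p k by (intro power_decreasing) auto
  also have "\<dots> = exp (- real N * p + p * real K)"
    using k by (simp add: of_nat_diff algebra_simps flip: exp_of_nat_mult)
  finally have 2: "(1 - p) ^ (N - k) \<le> exp (- real N * p + p * real K)" .
  show ?thesis unfolding Bernstein_def using 1 2 p by (intro mult_mono) auto
qed

text \<open>\<open>K\<close> lies above \<open>i / 2\<close> by up to 2; this margin later absorbs
  the fluctuation of the edge count and the width of a grid cell. The sum is governed by its last
  term, and the cost of the margin is contained in \<open>exp 8\<close>.\<close>

lemma Bernstein_lower_tail:
  assumes N: "N \<ge> 1" and i: "i \<ge> 8" "real i ^ 2 \<le> real N" and K: "K = i div 2 + 2"
  shows "(\<Sum>k\<le>K. Bernstein N k (real i / real N)) \<le> exp 8 * exp (- rate * real i) / sqrt (real i)"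
proof -
  let ?p = "real i / real N"
  let ?x = "real i"
  have ii: "real i * 1 \<le> real i * real i" using i by (intro mult_left_mono) auto
  have iN: "i \<le> N" using ii i(2) unfolding power2_eq_square by linarith
  have x: "real N * ?p = ?x" using N by simp
  have "2 * K \<le> i + 4" "i + 3 \<le> 2 * K" unfolding K by presburger+
  then have K1: "2 * real K \<le> ?x + 4" "?x + 3 \<le> 2 * real K" by linarith+
  have Ki: "K \<le> i" using K i by linarith
  have pK: "?p * real K \<le> 1"
  proof -
    have "real i * real K \<le> real i * real i" using Ki by (intro mult_left_mono) auto
    also have "\<dots> \<le> real N" using i by (simp add: power2_eq_square)
    finally show ?thesis using N by (simp add: field_simps)
  qed
  have "(\<Sum>k\<le>K. Bernstein N k ?p) \<le> (\<Sum>k\<le>K. ?x ^ k / fact k * exp (- ?x + 1))"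
  proof (rule sum_mono)
    fix k assume k: "k \<in> {..K}"
    have "Bernstein N k ?p \<le> (real N * ?p) ^ k / fact k * exp (- real N * ?p + ?p * real K)"
      using k Ki iN N by (intro Bernstein_le_poisson) auto
    also have "\<dots> \<le> ?x ^ k / fact k * exp (- ?x + 1)"
      using pK N by (simp add: divide_right_mono mult_left_mono)
    finally show "Bernstein N k ?p \<le> ?x ^ k / fact k * exp (- ?x + 1)" .
  qed
  also have "\<dots> = (\<Sum>k\<le>K. ?x ^ k / fact k) * exp (- ?x + 1)" by (simp add: sum_distrib_right)
  \<comment> \<open>This is where \<open>i \<ge> 8\<close> matters: it brings
    \<open>K \<le> i / 2 + 2\<close> below \<open>3 * i / 4\<close>.\<close>
  also have "\<dots> \<le> 4 * (?x ^ K / fact K) * exp (- ?x + 1)"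
    using K1 i by (intro mult_right_mono poisson_sum_le) auto
  also have "?x ^ K / fact K \<le> 2 * exp (real K * (1 + ln 2)) / sqrt ?x"
  proof -
    have K0: "K \<ge> 1" using K by simp
    have "?x ^ K / fact K \<le> (2 * real K) ^ K / (sqrt K * (real K / exp 1) ^ K)"
      using fact_lower[OF K0] K1 K0 by (intro frac_le power_mono) auto
    also have "\<dots> = exp (real K * (1 + ln 2)) / sqrt K"
      unfolding two_e_power[symmetric] using K0 by (simp add: power_mult_distrib power_divide field_simps)
    also have "\<dots> \<le> exp (real K * (1 + ln 2)) / (sqrt ?x / 2)"
    proof -
      have "sqrt ?x \<le> sqrt (2\<^sup>2 * K)" using K1 by (intro real_sqrt_le_mono) simp
      also have "\<dots> = 2 * sqrt K" by (simp add: real_sqrt_mult)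
      finally show ?thesis using K0 i by (intro divide_left_mono) auto
    qed
    finally show ?thesis by (simp add: field_simps)
  qed
  also have "4 * (2 * exp (real K * (1 + ln 2)) / sqrt ?x) * exp (- ?x + 1) =
      8 * exp (real K * (1 + ln 2) - ?x + 1) / sqrt ?x"
    by (simp add: exp_add exp_diff exp_minus field_simps)
  also have "\<dots> \<le> exp 3 * exp (real K * (1 + ln 2) - ?x + 1) / sqrt ?x"
  proof -
    have "(2::real) ^ 3 \<le> exp 1 ^ 3" using exp_ge_add_one_self[of 1] by (intro power_mono) auto
    then show ?thesis by (intro divide_right_mono mult_right_mono) (auto simp flip: exp_of_nat_mult)
  qed
  also have "\<dots> = exp (real K * (1 + ln 2) - ?x + 4) / sqrt ?x" by (simp add: algebra_simps flip: exp_add)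
  also have "\<dots> \<le> exp (8 - rate * ?x) / sqrt ?x"
  proof -
    have "real K * (1 + ln 2) \<le> (?x + 4) / 2 * (1 + ln 2)" using K1 by (intro mult_right_mono) auto
    then have "real K * (1 + ln 2) - ?x + 4 \<le> 8 - rate * ?x"
      using ln2_le_25_over_36 by (simp add: rate_def field_simps)
    then show ?thesis by (intro divide_right_mono) auto
  qed
  finally show ?thesis by (simp add: exp_diff exp_minus field_simps)
qed

text \<open>Exponential moments: a term with \<open>real k \<le> a\<close> is weighted by
  \<open>exp (t * (a - real k))\<close>, which is at least 1, and the enlarged sum over all
  \<open>k\<close> is evaluated by the binomial theorem.\<close>

lemma Bernstein_chernoff:
  assumes p: "0 \<le> p" "p \<le> 1" and t: "t \<ge> 0"
  shows "(\<Sum>k | k \<le> N \<and> real k \<le> a. Bernstein N k p) \<le> exp (t * a - real N * p * (1 - exp (- t)))"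
proof -
  have "(\<Sum>k | k \<le> N \<and> real k \<le> a. Bernstein N k p) \<le>
      (\<Sum>k | k \<le> N \<and> real k \<le> a. Bernstein N k p * (exp (t * a) * exp (- t) ^ k))"
  proof (rule sum_mono)
    fix k assume k: "k \<in> {k. k \<le> N \<and> real k \<le> a}"
    have "0 \<le> t * (a - real k)" using k t by auto
    then have "1 \<le> exp (t * a - t * real k)" by (simp add: algebra_simps)
    also have "\<dots> = exp (t * a) * exp (- t) ^ k" by (simp add: exp_diff exp_minus field_simps flip: exp_of_nat_mult)
    finally show "Bernstein N k p \<le> Bernstein N k p * (exp (t * a) * exp (- t) ^ k)"
      using Bernstein_nonneg[OF p, of N k] mult_left_mono[of 1] by fastforce
  qed
  also have "\<dots> \<le> (\<Sum>k\<le>N. Bernstein N k p * (exp (t * a) * exp (- t) ^ k))"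
    using Bernstein_nonneg[OF p] by (intro sum_mono2) auto
  also have "\<dots> = exp (t * a) * (\<Sum>k\<le>N. real (N choose k) * (p * exp (- t)) ^ k * (1 - p) ^ (N - k))"
    by (simp add: Bernstein_def sum_distrib_left power_mult_distrib mult_ac)
  also have "(\<Sum>k\<le>N. real (N choose k) * (p * exp (- t)) ^ k * (1 - p) ^ (N - k)) = (p * exp (- t) + (1 - p)) ^ N"
    using binomial_ring[of "p * exp (- t)" "1 - p" N] by simp
  also have "\<dots> \<le> exp (- p * (1 - exp (- t))) ^ N"
  proof (rule power_mono)
    show "p * exp (- t) + (1 - p) \<le> exp (- p * (1 - exp (- t)))"
      using exp_ge_add_one_self[of "- p * (1 - exp (- t))"] by (simp add: algebra_simps)
    show "0 \<le> p * exp (- t) + (1 - p)" using p by simp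
  qed
  also have "exp (t * a) * \<dots> = exp (t * a - real N * p * (1 - exp (- t)))"
    by (simp add: exp_add[symmetric] algebra_simps flip: exp_of_nat_mult)
  finally show ?thesis by simp
qed

section \<open>Degrees and edge counts at a fixed time\<close>

lemma open_edges_mono: "p \<le> p' \<Longrightarrow> open_edges A P p \<subseteq> open_edges A P p'"
  by (auto simp: open_edges_def)

lemma finite_open_edges: "A \<subseteq> kn_edges n \<Longrightarrow> finite (open_edges A P p)"
  by (rule finite_subset[OF _ finite_kn_edges[of n]]) (auto simp: open_edges_def)

lemma gp_edges_eq: "gp_edges n P p = card (open_edges (kn_edges n) P p)"
  by (simp add: gp_edges_def open_edges_def)

definition star :: "nat \<Rightarrow> nat \<Rightarrow> (nat \<times> nat) set" where
  "star n v = {e \<in> kn_edges n. fst e = v \<or> snd e = v}"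

lemma star_subset: "star n v \<subseteq> kn_edges n"
  by (auto simp: star_def)

text \<open>Neighbours are turned into edges, so that the laws proved for an arbitrary edge set
  apply to degrees.\<close>

lemma gp_degree_eq:
  assumes "v < n"
  shows "gp_degree n P p v = card (open_edges (star n v) P p)"
proof -
  have "bij_betw (\<lambda>u. (min u v, max u v)) {u. u < n \<and> u \<noteq> v \<and> P (min u v, max u v) \<le> p}
      (open_edges (star n v) P p)"
  proof (rule bij_betwI[where g = "\<lambda>(i, j). if i = v then j else i"])
    show "(\<lambda>u. (min u v, max u v)) \<in> {u. u < n \<and> u \<noteq> v \<and> P (min u v, max u v) \<le> p} \<rightarrow> open_edges (star n v) P p"
      using assms by (auto simp: open_edges_def star_def kn_edges_def min_def max_def)
    show "(\<lambda>(i, j). if i = v then j else i) \<in> open_edges (star n v) P p \<rightarrow> {u. u < n \<and> u \<noteq> v \<and> P (min u v, max u v) \<le> p}"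
      using assms by (auto simp: open_edges_def star_def kn_edges_def min_def max_def)
  qed (auto simp: open_edges_def star_def kn_edges_def min_def max_def)
  then show ?thesis unfolding gp_degree_def by (rule bij_betw_same_card)
qed

lemma card_star:
  assumes "v < n"
  shows "card (star n v) = n - 1"
proof -
  have "card (star n v) = gp_degree n (\<lambda>_. 0) 0 v"
    unfolding gp_degree_eq[OF assms] by (simp add: open_edges_def)
  also have "{u. u < n \<and> u \<noteq> v} = {..<n} - {v}" by auto
  then have "gp_degree n (\<lambda>_. 0) 0 v = n - 1" using assms by (simp add: gp_degree_def)
  finally show ?thesis .
qed

lemma card_kn_edges: "real (card (kn_edges n)) = real n * (real n - 1) / 2"
proof (induction n)
  case 0
  then show ?case by (simp add: kn_edges_def)
next
  case (Suc n)
  have "kn_edges (Suc n) = kn_edges n \<union> (\<lambda>i. (i, n)) ` {..<n}"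
    by (auto simp: kn_edges_def less_Suc_eq)
  moreover have "card (kn_edges n \<union> (\<lambda>i. (i, n)) ` {..<n}) = card (kn_edges n) + card ((\<lambda>i. (i, n)) ` {..<n})"
    by (rule card_Un_disjoint[OF finite_kn_edges]) (auto simp: kn_edges_def)
  moreover have "card ((\<lambda>i. (i, n)) ` {..<n}) = n"
    by (subst card_image) (auto simp: inj_on_def)
  ultimately show ?case using Suc by (simp add: field_simps)
qed

lemma gp_mindeg_le: "v < n \<Longrightarrow> gp_mindeg n P p \<le> gp_degree n P p v"
  unfolding gp_mindeg_def by (intro Min_le) auto

lemma gp_mindeg_gt:
  assumes "n > 0" "\<And>v. v < n \<Longrightarrow> real (gp_degree n P p v) > c"
  shows "real (gp_mindeg n P p) > c"
proof -
  have "gp_mindeg n P p \<in> gp_degree n P p ` {..<n}"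
    unfolding gp_mindeg_def using assms(1) by (intro Min_in) auto
  then show ?thesis using assms(2) by auto
qed

lemma gp_degree_mono: "v < n \<Longrightarrow> p \<le> p' \<Longrightarrow> gp_degree n P p v \<le> gp_degree n P p' v"
  unfolding gp_degree_eq by (intro card_mono finite_open_edges[OF star_subset] open_edges_mono)

lemma gp_edges_mono: "p \<le> p' \<Longrightarrow> gp_edges n P p \<le> gp_edges n P p'"
  unfolding gp_edges_eq by (intro card_mono finite_open_edges[OF order_refl] open_edges_mono)

text \<open>By right-continuity in \<open>p\<close> it suffices to look at the rational \<open>p\<close> and at the right endpoint.\<close>

lemma process_event_sets:
  assumes "0 \<le> lo" "hi \<le> 1"
  shows "{P \<in> space (graph_process n). \<forall>p\<in>{lo..hi}. R (open_edges (kn_edges n) P p)} \<in> sets (graph_process n)"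
proof -
  define C where "C = {lo..hi} \<inter> insert hi (\<rat> :: real set)"
  have C: "countable C" "C \<subseteq> {lo..hi}" by (auto simp: C_def countable_rat)
  have "\<exists>r\<in>C. open_edges (kn_edges n) P r = open_edges (kn_edges n) P p" if p: "p \<in> {lo..hi}" for P p
  proof (cases "p = hi")
    case True
    then show ?thesis using p by (auto simp: C_def)
  next
    case False
    \<comment> \<open>\<open>m\<close> is the next time after \<open>p\<close> at which an edge
      opens, capped at \<open>hi\<close>. The open edge set does not change from \<open>p\<close>
      until just before \<open>m\<close>, and a rational time fits in between.\<close>
    define m where "m = Min (insert hi (P ` {e \<in> kn_edges n. P e > p}))"
    have fin: "finite (insert hi (P ` {e \<in> kn_edges n. P e > p}))" by simp
    have "m > p" unfolding m_def using fin p False by (subst Min_gr_iff) auto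
    then obtain r where r: "r \<in> \<rat>" "p < r" "r < m" using Rats_dense_in_real by blast
    have le: "m \<le> hi" "\<And>e. e \<in> kn_edges n \<Longrightarrow> P e > p \<Longrightarrow> m \<le> P e"
      unfolding m_def using fin by (auto intro!: Min_le)
    have "open_edges (kn_edges n) P r = open_edges (kn_edges n) P p"
    proof -
      have "P e \<le> r \<longleftrightarrow> P e \<le> p" if "e \<in> kn_edges n" for e
        using le(2)[OF that] r by force
      then show ?thesis by (auto simp: open_edges_def)
    qed
    moreover have "r \<in> C" using r p le(1) by (auto simp: C_def)
    ultimately show ?thesis by blast
  qed
  then have "(\<forall>p\<in>{lo..hi}. R (open_edges (kn_edges n) P p)) \<longleftrightarrow> (\<forall>p\<in>C. R (open_edges (kn_edges n) P p))" for P
    using C(2) by (metis subsetD)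
  moreover have "{P \<in> space (graph_process n). \<forall>p\<in>C. R (open_edges (kn_edges n) P p)} \<in> sets (graph_process n)"
    using C assms by (intro sets.sets_Collect_countable_All' open_edges_prob(1)) auto
  ultimately show ?thesis by simp
qed

text \<open>The minimum degree depends on \<open>P\<close> and \<open>p\<close> only through the set
  of open edges, which is the form that \<open>process_event_sets\<close> requires.\<close>

lemma gp_mindeg_open_edges:
  "gp_mindeg n P p = Min ((\<lambda>v. card (open_edges (kn_edges n) P p \<inter> star n v)) ` {..<n})"
proof -
  have "gp_degree n P p v = card (open_edges (kn_edges n) P p \<inter> star n v)" if "v < n" for v
    unfolding gp_degree_eq[OF that] by (rule arg_cong[of _ _ card]) (auto simp: open_edges_def star_def)
  then show ?thesis unfolding gp_mindeg_def by (intro arg_cong[of _ _ Min] image_cong) auto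
qed

lemma gp_event_sets:
  assumes "0 \<le> lo" "hi \<le> 1"
  shows "{P \<in> space (graph_process n). \<forall>p\<in>{lo..hi}. R (gp_mindeg n P p) (gp_edges n P p)} \<in> sets (graph_process n)"
  unfolding gp_mindeg_open_edges gp_edges_eq
  using process_event_sets[OF assms, of n "\<lambda>S. R (Min ((\<lambda>v. card (S \<inter> star n v)) ` {..<n})) (card S)"] by simp

lemma gp_degree_event_sets:
  assumes "v < n" "0 \<le> p" "p \<le> 1"
  shows "{P \<in> space (graph_process n). R (gp_degree n P p v)} \<in> sets (graph_process n)"
  unfolding gp_degree_eq[OF assms(1)] by (rule open_edges_prob(1)[OF star_subset assms(2,3)])

lemma gp_all_degrees_event_sets:
  assumes "0 \<le> p" "p \<le> 1"
  shows "{P \<in> space (graph_process n). \<forall>v<n. R (gp_degree n P p v)} \<in> sets (graph_process n)"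
  using sets.sets_Collect_finite_All[of "{..<n}" "graph_process n" "\<lambda>v P. R (gp_degree n P p v)"]
    gp_degree_event_sets[OF _ assms] by (simp add: Ball_def)

lemma gp_edges_event_sets:
  assumes "0 \<le> p" "p \<le> 1"
  shows "{P \<in> space (graph_process n). R (gp_edges n P p)} \<in> sets (graph_process n)"
  unfolding gp_edges_eq by (rule open_edges_prob(1)[OF order_refl assms])

lemma gp_edges_chebyshev:
  assumes n: "n \<ge> 2" and p: "0 \<le> p" "p \<le> 1" and t: "t > 0"
  shows "measure (graph_process n) {P \<in> space (graph_process n).
      \<bar>real (gp_edges n P p) - real n * (real n - 1) / 2 * p\<bar> \<ge> t} \<le> real n * (real n - 1) / 2 * p / t\<^sup>2"
  using open_edges_chebyshev[OF order_refl p t, of n] unfolding gp_edges_eq card_kn_edges .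

lemma gp_degree_prob:
  assumes "v < n" "0 \<le> p" "p \<le> 1"
  shows "measure (graph_process n) {P \<in> space (graph_process n). R (gp_degree n P p v)} =
     (\<Sum>k | k \<le> n - 1 \<and> R k. Bernstein (n - 1) k p)"
  unfolding gp_degree_eq[OF assms(1)] using open_edges_card_prob[OF star_subset assms(2,3), where R = R]
  by (simp add: card_star assms(1))

section \<open>Joint law of two degrees\<close>

text \<open>Conditioning on the state of one edge outside \<open>B\<close>. It serves to split off
  the edge joining two vertices, which is the only dependence between their degrees.\<close>

lemma reveal_edge:
  assumes f: "f \<in> kn_edges n" and B: "B \<subseteq> kn_edges n" "f \<notin> B" and p: "0 \<le> p" "p \<le> 1"
  shows "measure (graph_process n) {P \<in> space (graph_process n). Q (P f \<le> p) (open_edges B P p)} =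
     p * measure (graph_process n) {P \<in> space (graph_process n). Q True (open_edges B P p)} +
     (1 - p) * measure (graph_process n) {P \<in> space (graph_process n). Q False (open_edges B P p)}"
proof -
  interpret prob_space "graph_process n" by (rule prob_space_graph_process)
  have ff: "{f} \<subseteq> kn_edges n" "{f} \<inter> B = {}" using f B by auto
  have op: "open_edges {f} P p = {f} \<longleftrightarrow> P f \<le> p" "open_edges {f} P p = {} \<longleftrightarrow> \<not> P f \<le> p" for P
    by (auto simp: open_edges_def)
  have 1: "prob {P \<in> space (graph_process n). P f \<le> p \<and> Q True (open_edges B P p)} =
      p * prob {P \<in> space (graph_process n). Q True (open_edges B P p)}"
    using open_edges_indep[OF ff(1) B(1) ff(2) p, of "\<lambda>S. S = {f}" "Q True"]
      open_edges_eq_prob(2)[OF ff(1) order_refl p] by (simp add: op)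
  have 2: "prob {P \<in> space (graph_process n). \<not> P f \<le> p \<and> Q False (open_edges B P p)} =
      (1 - p) * prob {P \<in> space (graph_process n). Q False (open_edges B P p)}"
    using open_edges_indep[OF ff(1) B(1) ff(2) p, of "\<lambda>S. S = {}" "Q False"]
      open_edges_eq_prob(2)[OF ff(1) empty_subsetI p] by (simp add: op)
  have fB: "insert f B \<subseteq> kn_edges n" using ff B by auto
  have op': "open_edges (insert f B) P p - {f} = open_edges B P p" "f \<in> open_edges (insert f B) P p \<longleftrightarrow> P f \<le> p" for P
    using B by (auto simp: open_edges_def)
  have s1: "{P \<in> space (graph_process n). P f \<le> p \<and> Q True (open_edges B P p)} \<in> events"
    using open_edges_prob(1)[OF fB p, of "\<lambda>S. f \<in> S \<and> Q True (S - {f})"] by (simp add: op')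
  have s2: "{P \<in> space (graph_process n). \<not> P f \<le> p \<and> Q False (open_edges B P p)} \<in> events"
    using open_edges_prob(1)[OF fB p, of "\<lambda>S. f \<notin> S \<and> Q False (S - {f})"] by (simp add: op')
  have "{P \<in> space (graph_process n). Q (P f \<le> p) (open_edges B P p)} =
      {P \<in> space (graph_process n). P f \<le> p \<and> Q True (open_edges B P p)} \<union>
      {P \<in> space (graph_process n). \<not> P f \<le> p \<and> Q False (open_edges B P p)}" (is "?L = ?A \<union> ?B")
    by (auto split: if_splits) (metis (full_types))+
  moreover have "prob (?A \<union> ?B) = prob ?A + prob ?B"
    by (rule finite_measure_Union[OF s1 s2]) auto
  ultimately show ?thesis using 1 2 by simp
qed

text \<open>The ratio of successive terms, \<open>(M - k) * p / ((k + 1) * (1 - p))\<close>, is at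
  least 1 as long as \<open>k + 1 \<le> (M + 1) * p\<close>.\<close>

lemma Bernstein_increasing:
  assumes p: "0 \<le> p" "p < 1" and k: "real (Suc k) \<le> (real M + 1) * p"
  shows "Bernstein M k p \<le> Bernstein M (Suc k) p"
proof -
  have "real (Suc k) < real M + 1"
  proof (rule le_less_trans[OF k])
    show "(real M + 1) * p < real M + 1" using p by simp
  qed
  then have kM: "k < M" by simp
  have c: "real (M choose Suc k) * real (Suc k) = real (M choose k) * real (M - k)"
  proof -
    have "(M choose Suc k) * Suc k = (M choose k) * (M - k)"
      using binomial_absorb_comp[of M k] binomial_absorption[of k M] by (simp only: mult.commute)
    then show ?thesis by (simp only: flip: of_nat_mult)
  qed
  have e: "(1 - p) ^ (M - k) = (1 - p) * (1 - p) ^ (M - Suc k)" using kM by (simp flip: power_Suc add: Suc_diff_Suc)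
  have "real (Suc k) * Bernstein M k p = real (M choose k) * p ^ k * (1 - p) ^ (M - Suc k) * (real (Suc k) * (1 - p))"
    by (simp add: Bernstein_def e)
  also have "\<dots> \<le> real (M choose k) * p ^ k * (1 - p) ^ (M - Suc k) * (real (M - k) * p)"
    using k kM p by (intro mult_left_mono) (auto simp: of_nat_diff algebra_simps)
  also have "\<dots> = real (M choose k) * real (M - k) * p ^ Suc k * (1 - p) ^ (M - Suc k)" by simp
  also have "\<dots> = real (Suc k) * Bernstein M (Suc k) p" unfolding c[symmetric] by (simp add: Bernstein_def)
  finally show ?thesis by (simp add: mult_le_cancel_left del: of_nat_Suc)
qed

text \<open>Let \<open>a\<close> and \<open>b\<close> be the probabilities of degree
  \<open>k\<close> given that the edge uv is open or closed. The joint probability is the mean of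
  their squares and exceeds the square of their mean by the variance
  \<open>p * (1 - p) * (b - a)\<^sup>2\<close>. As \<open>k\<close> is at most the mean degree,
  \<open>0 \<le> a \<le> b\<close>, so the excess is small relative to
  \<open>b\<^sup>2\<close>.\<close>

lemma gp_degree_pair:
  assumes uv: "u < n" "v < n" "u \<noteq> v" and p: "0 \<le> p" "p < 1" and k: "real k \<le> (real n - 1) * p"
  shows "measure (graph_process n) {P \<in> space (graph_process n). gp_degree n P p u = k \<and> gp_degree n P p v = k}
     \<le> (1 + p / (1 - p)) * (Bernstein (n - 1) k p)\<^sup>2"
proof -
  interpret prob_space "graph_process n" by (rule prob_space_graph_process)
  have p1: "p \<le> 1" using p by simp
  define f where "f = (min u v, max u v)"
  define Su where "Su = star n u - {f}"
  define Sv where "Sv = star n v - {f}"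
  have f: "f \<in> kn_edges n" "f \<in> star n u" "f \<in> star n v"
    using uv by (auto simp: f_def star_def kn_edges_def min_def max_def)
  have dis: "Su \<inter> Sv = {}"
    using uv by (auto simp: Su_def Sv_def f_def star_def kn_edges_def min_def max_def)
  have sub: "Su \<subseteq> kn_edges n" "Sv \<subseteq> kn_edges n" using star_subset by (auto simp: Su_def Sv_def)
  have card: "card Su = n - 2" "card Sv = n - 2"
    using f(2,3) by (simp_all add: Su_def Sv_def card_star uv)
  have nf: "f \<notin> Su" "f \<notin> Sv" "f \<notin> Su \<union> Sv" by (auto simp: Su_def Sv_def)
  have ins: "star n u = insert f Su" "star n v = insert f Sv" using f by (auto simp: Su_def Sv_def)
  have opins: "card (open_edges (insert f S) P p) = card (open_edges S P p) + of_bool (P f \<le> p)"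
    if "S \<subseteq> kn_edges n" "f \<notin> S" for S P
  proof -
    have "open_edges (insert f S) P p = (if P f \<le> p then insert f (open_edges S P p) else open_edges S P p)"
      by (auto simp: open_edges_def)
    moreover have "f \<notin> open_edges S P p" using that by (auto simp: open_edges_def)
    ultimately show ?thesis using finite_open_edges[OF that(1)] by simp
  qed
  have deg: "gp_degree n P p u = card (open_edges Su P p) + of_bool (P f \<le> p)"
    "gp_degree n P p v = card (open_edges Sv P p) + of_bool (P f \<le> p)" for P
    using uv sub nf by (simp_all add: gp_degree_eq ins opins)
  \<comment> \<open>An open joining edge leaves \<open>k - 1\<close> neighbours to come from the
    other \<open>n - 2\<close> vertices, which is impossible for \<open>k = 0\<close>; a closed one
    leaves \<open>k\<close>.\<close>
  define a where "a = (if k = 0 then 0 else Bernstein (n - 2) (k - 1) p)"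
  define b where "b = Bernstein (n - 2) k p"
  have pa: "prob {P \<in> space (graph_process n). Suc (card (open_edges S P p)) = k} = a"
    if "S \<subseteq> kn_edges n" "card S = n - 2" for S
  proof (cases k)
    case (Suc j)
    then show ?thesis using open_edges_card_eq_prob[OF that(1) p(1) p1, of j] that by (simp add: a_def)
  qed (simp add: a_def)
  have pb: "prob {P \<in> space (graph_process n). card (open_edges S P p) = k} = b"
    if "S \<subseteq> kn_edges n" "card S = n - 2" for S
    using open_edges_card_eq_prob[OF that(1) p(1) p1, of k] that by (simp add: b_def)
  have "Bernstein (n - 1) k p = prob {P \<in> space (graph_process n). gp_degree n P p u = k}"
    using open_edges_card_eq_prob[OF star_subset p(1) p1, of n u k] uv by (simp add: gp_degree_eq card_star)
  also have "\<dots> = p * a + (1 - p) * b"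
    using reveal_edge[OF f(1) sub(1) nf(1) p(1) p1, of "\<lambda>t S. card S + of_bool t = k"] pa[OF sub(1) card(1)] pb[OF sub(1) card(1)]
    by (simp add: deg)
  finally have q: "Bernstein (n - 1) k p = p * a + (1 - p) * b" .
  have opun: "open_edges (Su \<union> Sv) P p \<inter> Su = open_edges Su P p" "open_edges (Su \<union> Sv) P p \<inter> Sv = open_edges Sv P p" for P
    by (auto simp: open_edges_def)
  have "prob {P \<in> space (graph_process n). gp_degree n P p u = k \<and> gp_degree n P p v = k} =
     p * prob {P \<in> space (graph_process n). Suc (card (open_edges Su P p)) = k \<and> Suc (card (open_edges Sv P p)) = k} +
     (1 - p) * prob {P \<in> space (graph_process n). card (open_edges Su P p) = k \<and> card (open_edges Sv P p) = k}"
    using reveal_edge[OF f(1) _ nf(3) p(1) p1, of "\<lambda>t S. card (S \<inter> Su) + of_bool t = k \<and> card (S \<inter> Sv) + of_bool t = k"] sub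
    by (simp add: deg opun)
  also have "\<dots> = p * (a * a) + (1 - p) * (b * b)"
    using open_edges_indep[OF sub dis p(1) p1, of "\<lambda>S. Suc (card S) = k" "\<lambda>S. Suc (card S) = k"]
      open_edges_indep[OF sub dis p(1) p1, of "\<lambda>S. card S = k" "\<lambda>S. card S = k"]
      pa[OF sub(1) card(1)] pb[OF sub(1) card(1)] pa[OF sub(2) card(2)] pb[OF sub(2) card(2)] by simp
  finally have pr: "prob {P \<in> space (graph_process n). gp_degree n P p u = k \<and> gp_degree n P p v = k} =
      p * (a * a) + (1 - p) * (b * b)" .
  have a0: "0 \<le> a" "0 \<le> b" using Bernstein_nonneg[OF p(1) p1] by (auto simp: a_def b_def)
  have ab: "a \<le> b"
  proof (cases k)
    case (Suc j)
    have "real (n - 2) + 1 = real n - 1" using uv by (simp add: of_nat_diff)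
    then show ?thesis using Bernstein_increasing[OF p, of j "n - 2"] k Suc by (simp add: a_def b_def)
  qed (use a0 in \<open>simp add: a_def\<close>)
  have "p * (a * a) + (1 - p) * (b * b) = (p * a + (1 - p) * b)\<^sup>2 + p * (1 - p) * (b - a)\<^sup>2"
    by (simp add: power2_eq_square algebra_simps)
  also have "p * (1 - p) * (b - a)\<^sup>2 \<le> p / (1 - p) * (p * a + (1 - p) * b)\<^sup>2"
  proof -
    have "p * (1 - p) * (b - a)\<^sup>2 \<le> p * (1 - p) * b\<^sup>2"
      using p a0 ab by (intro mult_left_mono power_mono) auto
    also have "\<dots> = p / (1 - p) * ((1 - p) * b)\<^sup>2" using p by (simp add: power2_eq_square)
    also have "\<dots> \<le> p / (1 - p) * (p * a + (1 - p) * b)\<^sup>2"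
      using p a0 by (intro mult_left_mono power_mono) auto
    finally show ?thesis .
  qed
  finally show ?thesis unfolding pr q by (simp add: algebra_simps)
qed

lemma no_vertex_of_degree:
  assumes n: "n \<ge> 2" and p: "0 < p" "p < 1" and k: "real k \<le> (real n - 1) * p"
  shows "measure (graph_process n) {P \<in> space (graph_process n). \<forall>v<n. gp_degree n P p v \<noteq> k}
     \<le> 1 / (real n * Bernstein (n - 1) k p) + p / (1 - p)"
proof -
  interpret prob_space "graph_process n" by (rule prob_space_graph_process)
  have p': "0 \<le> p" "p \<le> 1" using p by auto
  let ?E = "\<lambda>v. {P \<in> space (graph_process n). gp_degree n P p v = k}"
  have "real k \<le> real (n - 1)"
  proof -
    have "(real n - 1) * p \<le> (real n - 1) * 1" using n p by (intro mult_left_mono) auto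
    then have "real k \<le> real n - 1" using order_trans[OF k] by simp
    then show ?thesis using n by (simp add: of_nat_diff)
  qed
  then have q0: "Bernstein (n - 1) k p > 0" using p by (intro Bernstein_pos) auto
  have "prob (space (graph_process n) - (\<Union>v\<in>{..<n}. ?E v)) \<le>
      1 / (real (card {..<n}) * Bernstein (n - 1) k p) + p / (1 - p)"
  proof (rule second_moment_none[OF _ _ _ _ q0])
    show "?E v \<in> events" if "v \<in> {..<n}" for v using that p' by (intro gp_degree_event_sets) auto
    show "prob (?E v) = Bernstein (n - 1) k p" if "v \<in> {..<n}" for v
      using open_edges_card_eq_prob[OF star_subset p', of n v k] that by (simp add: gp_degree_eq card_star)
    show "prob (?E u \<inter> ?E v) \<le> (1 + p / (1 - p)) * (Bernstein (n - 1) k p)\<^sup>2"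
      if "u \<in> {..<n}" "v \<in> {..<n}" "u \<noteq> v" for u v
    proof -
      have "?E u \<inter> ?E v = {P \<in> space (graph_process n). gp_degree n P p u = k \<and> gp_degree n P p v = k}" by auto
      then show ?thesis using gp_degree_pair[of u n v p k] that p p' k by simp
    qed
  qed (use n p in \<open>auto simp: lessThan_empty_iff\<close>)
  also have "space (graph_process n) - (\<Union>v\<in>{..<n}. ?E v) =
      {P \<in> space (graph_process n). \<forall>v<n. gp_degree n P p v \<noteq> k}" by auto
  finally show ?thesis by simp
qed

section \<open>Failure probabilities at the grid points\<close>

lemma (in prob_space) prob_ge_one_minus:
  assumes "E \<in> events" "finite I" "\<And>i. i \<in> I \<Longrightarrow> B i \<in> events" "\<And>i. i \<in> I \<Longrightarrow> prob (B i) \<le> c i"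
    and "\<And>x. x \<in> space M \<Longrightarrow> (\<And>i. i \<in> I \<Longrightarrow> x \<notin> B i) \<Longrightarrow> x \<in> E"
  shows "prob E \<ge> 1 - (\<Sum>i\<in>I. c i)"
proof -
  have "1 - prob E = prob (space M - E)" using assms(1) by (simp add: prob_compl)
  also have "\<dots> \<le> prob (\<Union>i\<in>I. B i)"
    using assms(2,3) by (intro finite_measure_mono) (use assms(5) in blast, intro sets.finite_UN)
  also have "\<dots> \<le> (\<Sum>i\<in>I. prob (B i))" using assms(2,3) by (intro finite_measure_subadditive_finite) auto
  also have "\<dots> \<le> (\<Sum>i\<in>I. c i)" by (intro sum_mono assms(4))
  finally show ?thesis by simp
qed

lemma gp_range_event_sets:
  "{P \<in> space (graph_process n). \<forall>p\<in>{0..1}. lo \<le> p \<longrightarrow> p \<le> hi \<longrightarrow> real (gp_mindeg n P p) \<le> c * gp_avgdeg n P p} \<in> sets (graph_process n)"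
  "{P \<in> space (graph_process n). \<forall>p\<in>{0..1}. lo \<le> p \<longrightarrow> p \<le> hi \<longrightarrow> real (gp_mindeg n P p) > c * gp_avgdeg n P p} \<in> sets (graph_process n)"
proof -
  have eq: "(\<forall>p\<in>{0..1}. lo \<le> p \<longrightarrow> p \<le> hi \<longrightarrow> Q p) \<longleftrightarrow> (\<forall>p\<in>{max 0 lo..min 1 hi}. Q p)" for Q :: "real \<Rightarrow> bool"
    by auto
  show "{P \<in> space (graph_process n). \<forall>p\<in>{0..1}. lo \<le> p \<longrightarrow> p \<le> hi \<longrightarrow> real (gp_mindeg n P p) \<le> c * gp_avgdeg n P p} \<in> sets (graph_process n)"
    unfolding eq gp_avgdeg_def
    by (rule gp_event_sets[of _ _ n "\<lambda>d m. real d \<le> c * (2 * real m / (real n - 1))"]) auto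
  show "{P \<in> space (graph_process n). \<forall>p\<in>{0..1}. lo \<le> p \<longrightarrow> p \<le> hi \<longrightarrow> real (gp_mindeg n P p) > c * gp_avgdeg n P p} \<in> sets (graph_process n)"
    unfolding eq gp_avgdeg_def
    by (rule gp_event_sets[of _ _ n "\<lambda>d m. real d > c * (2 * real m / (real n - 1))"]) auto
qed

lemma grid_edges_deviation:
  assumes n: "n \<ge> 2" and i: "real i \<le> real n - 1" and t: "t > 0"
  defines "dev \<equiv> {P \<in> space (graph_process n). \<bar>real (gp_edges n P (real i / (real n - 1))) - real n * real i / 2\<bar> \<ge> t}"
  shows "dev \<in> sets (graph_process n)" "measure (graph_process n) dev \<le> real n * real i / (2 * t\<^sup>2)"
proof -
  have p: "0 \<le> real i / (real n - 1)" "real i / (real n - 1) \<le> 1" using n i by auto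
  show "dev \<in> sets (graph_process n)" unfolding dev_def by (rule gp_edges_event_sets[OF p])
  have "real n * (real n - 1) / 2 * (real i / (real n - 1)) = real n * real i / 2"
    using n by (simp add: divide_simps)
  then show "measure (graph_process n) dev \<le> real n * real i / (2 * t\<^sup>2)"
    using gp_edges_chebyshev[OF n p t] unfolding dev_def by (simp only: divide_divide_eq_left)
qed

lemma floor_grid:
  assumes "N > 0" "0 \<le> p"
  obtains i :: nat where "real i / N \<le> p" "p \<le> (real i + 1) / N" "real i \<le> N * p" "N * p < real i + 1"
proof -
  define i where "i = nat \<lfloor>N * p\<rfloor>"
  have "real i \<le> N * p" "N * p < real i + 1" using assms by (simp_all add: i_def)
  then show thesis using assms by (intro that[of i]) (auto simp: field_simps)
qed

section \<open>Grid cells below the threshold\<close>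

text \<open>A vertex of degree \<open>k\<close> at the right end of the cell has degree at most
  \<open>k\<close> throughout it, and the edge count at the left end is a lower bound throughout.
  The choice \<open>k = (i - 1) div 2\<close> gives \<open>2 * k + 1 \<le> i\<close> for positive
  \<open>i\<close>, which pays for a deviation of \<open>N / 2\<close> in the edge count.\<close>

lemma grid_low_vertex:
  assumes n: "n \<ge> 2" and i: "4 * (real i + 1)\<^sup>2 \<le> real n - 1"
  defines "N \<equiv> real n - 1"
  defines "B \<equiv> {P \<in> space (graph_process n). \<bar>real (gp_edges n P (real i / N)) - real n * real i / 2\<bar> \<ge> N / 2} \<union>
     {P \<in> space (graph_process n). \<forall>v<n. gp_degree n P ((real i + 1) / N) v \<noteq> (i - 1) div 2}"
  shows "B \<in> sets (graph_process n)"
    and "measure (graph_process n) B \<le> 6 * (real i + 1) / N + exp 7 * sqrt (real i + 1) * exp (rate * (real i + 1)) / real n"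
    and "P \<in> space (graph_process n) \<Longrightarrow> P \<notin> B \<Longrightarrow> real i / N \<le> p \<Longrightarrow> p \<le> (real i + 1) / N \<Longrightarrow>
       real (gp_mindeg n P p) \<le> real (gp_edges n P p) / N"
proof -
  interpret prob_space "graph_process n" by (rule prob_space_graph_process)
  define x where "x = real i + 1"
  define p' where "p' = x / N"
  define k where "k = (i - 1) div 2"
  have N: "N \<ge> 1" "N = real (n - 1)" using n by (auto simp: N_def)
  have x1: "x \<ge> 1" by (simp add: x_def)
  have xx: "x * 1 \<le> x * x" using x1 by (intro mult_left_mono) auto
  have x: "4 * x\<^sup>2 \<le> N" using i by (simp add: x_def N_def)
  have x4: "4 * x \<le> N" using x xx by (simp add: power2_eq_square)
  have p': "0 < p'" "p' \<le> 1/2" "p' < 1" "0 \<le> p'" "p' \<le> 1" using x1 x4 N by (auto simp: p'_def field_simps)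
  have k0: "2 * k \<le> i + 1" "i + 1 \<le> 2 * k + 3" "2 * k \<le> i" unfolding k_def by presburger+
  have k: "2 * real k \<le> x" "x \<le> 2 * real k + 3" "real k \<le> real i / 2"
    using k0 unfolding x_def by linarith+
  have iN: "real i \<le> real n - 1" using x4 x1 by (simp add: x_def N_def)
  have N2: "N / 2 > 0" using N by simp
  note dev = grid_edges_deviation[OF n iN N2, folded N_def]
  let ?B1 = "{P \<in> space (graph_process n). \<bar>real (gp_edges n P (real i / N)) - real n * real i / 2\<bar> \<ge> N / 2}"
  let ?B2 = "{P \<in> space (graph_process n). \<forall>v<n. gp_degree n P p' v \<noteq> k}"
  have B: "B = ?B1 \<union> ?B2" by (simp add: B_def p'_def k_def x_def)
  have B1: "?B1 \<in> events" "prob ?B1 \<le> real n * real i / (2 * (N/2)\<^sup>2)"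
    by (fact dev)+
  have B2: "?B2 \<in> events" by (rule gp_all_degrees_event_sets[OF p'(4,5)])
  have "?B1 \<union> ?B2 \<in> events" by (rule sets.Un[OF B1(1) B2])
  then show "B \<in> sets (graph_process n)" by (simp only: B)
  have Np: "N * p' = x" using N by (simp add: p'_def)
  have kp: "real k \<le> (real n - 1) * p'" using k x1 by (simp add: Np flip: N_def)
  have "prob ?B2 \<le> 1 / (real n * Bernstein (n - 1) k p') + p' / (1 - p')"
    by (rule no_vertex_of_degree[OF n p'(1,3) kp])
  also have "1 / (real n * Bernstein (n - 1) k p') \<le> exp 7 * sqrt x * exp (rate * x) / real n"
  proof -
    have "Bernstein (n - 1) k p' \<ge> exp (-7) * exp (- rate * x) / sqrt (real k + 1)"
      using n N x x1 p' k by (intro Bernstein_lower) (auto simp: p'_def)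
    moreover have "exp (-7) * exp (- rate * x) / sqrt (real k + 1) \<ge> exp (-7) * exp (- rate * x) / sqrt x"
      using k x1 by (intro divide_left_mono) (auto simp: x_def)
    ultimately have "Bernstein (n - 1) k p' \<ge> exp (-7) * exp (- rate * x) / sqrt x" by linarith
    then have "1 / (real n * Bernstein (n - 1) k p') \<le> 1 / (real n * (exp (-7) * exp (- rate * x) / sqrt x))"
      using n x1 by (intro divide_left_mono mult_left_mono mult_pos_pos) (auto intro: less_le_trans[rotated])
    also have "\<dots> = exp 7 * sqrt x * exp (rate * x) / real n" by (simp add: exp_minus field_simps)
    finally show ?thesis .
  qed
  also have "p' / (1 - p') \<le> 2 * x / N"
  proof -
    have "p' / (1 - p') \<le> p' / (1/2)" using p' by (intro divide_left_mono) auto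
    then show ?thesis by (simp add: p'_def mult_ac)
  qed
  finally have B2p: "prob ?B2 \<le> exp 7 * sqrt x * exp (rate * x) / real n + 2 * x / N" by simp
  have "real n * real i / (2 * (N/2)\<^sup>2) \<le> (2 * N) * real i / (2 * (N/2)\<^sup>2)"
    using n by (intro divide_right_mono mult_right_mono) (auto simp: N_def)
  also have "\<dots> = 4 * real i / N" using N(1) by (simp add: power2_eq_square field_simps)
  also have "\<dots> \<le> 4 * x / N" using N(1) by (intro divide_right_mono) (auto simp: x_def)
  finally have "prob ?B1 \<le> 4 * x / N" using B1 by simp
  then have "prob B \<le> 4 * x / N + (exp 7 * sqrt x * exp (rate * x) / real n + 2 * x / N)"
    using measure_Un_le[OF B1(1) B2] B2p unfolding B by linarith
  moreover have "4 * x / N + 2 * x / N = 6 * x / N" by (simp flip: add_divide_distrib)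
  ultimately show "measure (graph_process n) B \<le> 6 * (real i + 1) / N + exp 7 * sqrt (real i + 1) * exp (rate * (real i + 1)) / real n"
    unfolding x_def by linarith
  show "real (gp_mindeg n P p) \<le> real (gp_edges n P p) / N"
    if P: "P \<in> space (graph_process n)" "P \<notin> B" and p: "real i / N \<le> p" "p \<le> (real i + 1) / N"
  proof -
    obtain v where v: "v < n" "gp_degree n P p' v = k" using P unfolding B by auto
    have "gp_mindeg n P p \<le> gp_degree n P p v" by (rule gp_mindeg_le[OF v(1)])
    also have "\<dots> \<le> gp_degree n P p' v" using p by (intro gp_degree_mono v) (simp add: p'_def x_def)
    finally have 1: "gp_mindeg n P p \<le> k" using v by simp
    have "real k * N \<le> real (gp_edges n P (real i / N))"
    proof (cases "i = 0")
      \<comment> \<open>Truncated subtraction gives \<open>k = 0\<close> here;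
        \<open>2 * k + 1 \<le> i\<close> fails, but the claim is trivial.\<close>
      case True
      then show ?thesis by (simp add: k_def)
    next
      case False
      then have "2 * k + 1 \<le> i" unfolding k_def by presburger
      then have "2 * real k + 1 \<le> real i" by linarith
      then have "(2 * real k + 1) * N \<le> real i * N" using N by (intro mult_right_mono) auto
      also have "\<dots> \<le> real n * real i" by (simp add: N_def algebra_simps)
      finally have "(2 * real k + 1) * N \<le> real n * real i" .
      moreover have "\<bar>real (gp_edges n P (real i / N)) - real n * real i / 2\<bar> < N / 2" using P unfolding B by auto
      moreover have "(2 * real k + 1) * N = 2 * (real k * N) + N" by (simp add: algebra_simps)
      ultimately show ?thesis by linarith
    qed
    also have "\<dots> \<le> real (gp_edges n P p)" using p by (simp add: gp_edges_mono)
    finally have "real k * N \<le> real (gp_edges n P p)" .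
    moreover have "real (gp_mindeg n P p) * N \<le> real k * N" using 1 N by (intro mult_right_mono) auto
    ultimately have "real (gp_mindeg n P p) * N \<le> real (gp_edges n P p)" by linarith
    then show ?thesis using N(1) by (simp add: le_divide_eq)
  qed
qed

text \<open>The vertex terms are compared with a geometric progression of ratio
  \<open>exp rate\<close>, so their sum has the order of the last one; the edge terms are small
  enough to be bounded by the number of cells times the largest. One factor \<open>exp rate\<close>
  in the constant comes from the right endpoint \<open>i + 1\<close>, the other from the geometric
  sum.\<close>

lemma subcritical_bound:
  fixes x :: real
  assumes n: "n \<ge> 2" and x: "4 * (x + 1)\<^sup>2 \<le> real n - 1" "x \<ge> 0"
  shows "measure (graph_process n) {P \<in> space (graph_process n). \<forall>p\<in>{0..1}.
      p \<le> x / (real n - 1) \<longrightarrow> real (gp_mindeg n P p) \<le> gp_avgdeg n P p / 2}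
    \<ge> 1 - (6 * (x + 1)\<^sup>2 / (real n - 1) +
       exp 7 * exp (2 * rate) / (exp rate - 1) * (sqrt (x + 1) * exp (rate * x) / real n))"
proof -
  interpret prob_space "graph_process n" by (rule prob_space_graph_process)
  define N where "N = real n - 1"
  have N: "N \<ge> 1" using n by (simp add: N_def)
  define J where "J = nat \<lfloor>x\<rfloor>"
  have J: "real J \<le> x" using x by (simp add: J_def)
  let ?c = "\<lambda>i. 6 * (real i + 1) / N + exp 7 * sqrt (real i + 1) * exp (rate * (real i + 1)) / real n"
  let ?E = "{P \<in> space (graph_process n). \<forall>p\<in>{0..1}.
      p \<le> x / (real n - 1) \<longrightarrow> real (gp_mindeg n P p) \<le> gp_avgdeg n P p / 2}"
  have cond: "4 * (real i + 1)\<^sup>2 \<le> real n - 1" if "i \<le> J" for i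
  proof -
    have "(real i + 1)\<^sup>2 \<le> (x + 1)\<^sup>2" using that J by (intro power_mono) auto
    then show ?thesis using x by linarith
  qed
  note low = grid_low_vertex[OF n cond, folded N_def]
  have "prob ?E \<ge> 1 - (\<Sum>i\<le>J. ?c i)"
  proof (rule prob_ge_one_minus)
    show "?E \<in> events"
      using gp_range_event_sets(1)[where lo = 0 and hi = "x / (real n - 1)" and c = "1/2" and n = n] by simp
    fix P assume P: "P \<in> space (graph_process n)"
      "\<And>i. i \<in> {..J} \<Longrightarrow> P \<notin> {P \<in> space (graph_process n). \<bar>real (gp_edges n P (real i / N)) - real n * real i / 2\<bar> \<ge> N / 2} \<union>
     {P \<in> space (graph_process n). \<forall>v<n. gp_degree n P ((real i + 1) / N) v \<noteq> (i - 1) div 2}"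
    show "P \<in> ?E"
    proof (intro CollectI conjI ballI impI P)
      fix p :: real assume p: "p \<in> {0..1}" "p \<le> x / (real n - 1)"
      obtain i where i: "real i / N \<le> p" "p \<le> (real i + 1) / N" "real i \<le> N * p"
        using floor_grid[of N p] N p by auto
      have "N * p \<le> x" using p N by (simp add: N_def field_simps)
      then have "real i \<le> x" using i by linarith
      then have "i \<le> J" unfolding J_def by (simp add: le_nat_floor)
      then have "real (gp_mindeg n P p) \<le> real (gp_edges n P p) / N"
        using low(3)[OF _ P(1) P(2) i(1,2)] by blast
      then show "real (gp_mindeg n P p) \<le> gp_avgdeg n P p / 2" by (simp add: gp_avgdeg_def flip: N_def)
    qed
  next
    fix i assume "i \<in> {..J}"
    then have "i \<le> J" by simp
    from low(1,2)[OF this]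
    show "{P \<in> space (graph_process n). \<bar>real (gp_edges n P (real i / N)) - real n * real i / 2\<bar> \<ge> N / 2} \<union>
       {P \<in> space (graph_process n). \<forall>v<n. gp_degree n P ((real i + 1) / N) v \<noteq> (i - 1) div 2} \<in> events"
      "prob ({P \<in> space (graph_process n). \<bar>real (gp_edges n P (real i / N)) - real n * real i / 2\<bar> \<ge> N / 2} \<union>
       {P \<in> space (graph_process n). \<forall>v<n. gp_degree n P ((real i + 1) / N) v \<noteq> (i - 1) div 2}) \<le> ?c i" .
  qed simp
  moreover have "(\<Sum>i\<le>J. ?c i) \<le> 6 * (x + 1)\<^sup>2 / N + exp 7 * exp (2 * rate) / (exp rate - 1) * (sqrt (x + 1) * exp (rate * x) / real n)"
  proof -
    have "(\<Sum>i\<le>J. 6 * (real i + 1) / N) \<le> (\<Sum>i\<le>J. 6 * (x + 1) / N)"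
      using J N by (intro sum_mono divide_right_mono) auto
    also have "\<dots> = 6 * (x + 1) / N * (real J + 1)" by simp
    also have "\<dots> \<le> 6 * (x + 1) / N * (x + 1)" using J N x by (intro mult_left_mono) auto
    also have "\<dots> = 6 * (x + 1)\<^sup>2 / N" by (simp add: power2_eq_square)
    finally have 1: "(\<Sum>i\<le>J. 6 * (real i + 1) / N) \<le> 6 * (x + 1)\<^sup>2 / N" .
    have r: "exp rate > 1" using rate_pos by simp
    have "(\<Sum>i\<le>J. exp 7 * sqrt (real i + 1) * exp (rate * (real i + 1)) / real n) \<le>
        (\<Sum>i\<le>J. exp 7 * sqrt (x + 1) * (exp rate * exp rate ^ i) / real n)"
    proof (intro sum_mono divide_right_mono)
      fix i assume i: "i \<in> {..J}"
      have "exp (rate * (real i + 1)) = exp rate * exp rate ^ i"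
        by (simp add: algebra_simps exp_add flip: exp_of_nat_mult)
      then show "exp 7 * sqrt (real i + 1) * exp (rate * (real i + 1)) \<le> exp 7 * sqrt (x + 1) * (exp rate * exp rate ^ i)"
        using i J by (simp add: mult_right_mono)
    qed simp
    also have "\<dots> = exp 7 * sqrt (x + 1) * exp rate / real n * (\<Sum>i\<le>J. exp rate ^ i)"
      by (simp add: sum_distrib_left sum_divide_distrib algebra_simps)
    also have "\<dots> \<le> exp 7 * sqrt (x + 1) * exp rate / real n * (exp rate * exp (rate * x) / (exp rate - 1))"
    proof (rule mult_left_mono)
      have "(\<Sum>i\<le>J. exp rate ^ i) = (\<Sum>i<Suc J. exp rate ^ i)" by (simp only: lessThan_Suc_atMost)
      also have "\<dots> = (exp rate ^ Suc J - 1) / (exp rate - 1)"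
        using r by (subst geometric_sum) auto
      also have "\<dots> \<le> exp rate ^ Suc J / (exp rate - 1)" using r by (intro divide_right_mono) auto
      also have "exp rate ^ Suc J = exp rate * exp (rate * real J)"
        by (simp add: mult.commute flip: exp_of_nat_mult)
      also have "exp rate * exp (rate * real J) / (exp rate - 1) \<le> exp rate * exp (rate * x) / (exp rate - 1)"
        using r J rate_pos by (intro divide_right_mono mult_left_mono) auto
      finally show "(\<Sum>i\<le>J. exp rate ^ i) \<le> exp rate * exp (rate * x) / (exp rate - 1)" .
    qed (use x in auto)
    also have "\<dots> = exp 7 * exp (2 * rate) / (exp rate - 1) * (sqrt (x + 1) * exp (rate * x) / real n)"
    proof -
      have "exp (2 * rate) = exp rate * exp rate" by (simp add: exp_double power2_eq_square)
      then show ?thesis by (simp add: mult_ac)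
    qed
    finally show ?thesis using 1 by (simp add: sum.distrib)
  qed
  ultimately show ?thesis by (simp add: N_def)
qed

section \<open>Grid cells above the threshold\<close>

text \<open>The ends of the cell exchange roles: degrees are bounded below at the left end, the edge
  count above at the right end. Off \<open>B\<close>, twice any degree is at least
  \<open>i + 5\<close>, while \<open>2 * m / N\<close> stays below \<open>i + 3\<close>.\<close>

lemma grid_no_low_vertex:
  assumes n: "n \<ge> 2" and i: "i \<ge> 8" "(real i)\<^sup>2 \<le> real n - 1"
  defines "N \<equiv> real n - 1"
  defines "B \<equiv> {P \<in> space (graph_process n). \<bar>real (gp_edges n P (real (Suc i) / N)) - real n * real (Suc i) / 2\<bar> \<ge> N / 2} \<union>
     {P \<in> space (graph_process n). \<not> (\<forall>v<n. gp_degree n P (real i / N) v > i div 2 + 2)}"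
  shows "B \<in> sets (graph_process n)"
    and "measure (graph_process n) B \<le> 4 * (real i + 1) / N + real n * (exp 8 * exp (- rate * real i) / sqrt (real i))"
    and "P \<in> space (graph_process n) \<Longrightarrow> P \<notin> B \<Longrightarrow> real i / N \<le> p \<Longrightarrow> p \<le> (real i + 1) / N \<Longrightarrow>
       real (gp_mindeg n P p) > real (gp_edges n P p) / N"
proof -
  interpret prob_space "graph_process n" by (rule prob_space_graph_process)
  have N: "N \<ge> 1" "N = real (n - 1)" using n by (auto simp: N_def)
  define p0 where "p0 = real i / N"
  define K where "K = i div 2 + 2"
  have "8 * real i \<le> real i * real i" using i(1) by (intro mult_right_mono) auto
  then have "8 * real i \<le> N" using i(2) unfolding power2_eq_square N_def by linarith
  then have iN: "real i \<le> N" "real (Suc i) \<le> N" using i(1) by linarith+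
  then have iN': "real (Suc i) \<le> real n - 1" by (simp add: N_def)
  have p0: "0 \<le> p0" "p0 \<le> 1" using iN N by (auto simp: p0_def)
  have N2: "N / 2 > 0" using N by simp
  note dev = grid_edges_deviation[OF n iN' N2, folded N_def]
  let ?B1 = "{P \<in> space (graph_process n). \<bar>real (gp_edges n P (real (Suc i) / N)) - real n * real (Suc i) / 2\<bar> \<ge> N / 2}"
  let ?B2 = "{P \<in> space (graph_process n). \<not> (\<forall>v<n. gp_degree n P p0 v > K)}"
  let ?D = "\<lambda>v. {P \<in> space (graph_process n). gp_degree n P p0 v \<le> K}"
  have B: "B = ?B1 \<union> ?B2" by (simp add: B_def p0_def K_def)
  have B2: "?B2 = (\<Union>v\<in>{..<n}. ?D v)" by (auto simp: not_less)
  have D: "?D v \<in> events" if "v < n" for v by (rule gp_degree_event_sets[OF that p0])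
  have B2ev: "?B2 \<in> events" unfolding B2 using D by (intro sets.finite_UN) auto
  have "?B1 \<union> ?B2 \<in> events" by (rule sets.Un[OF dev(1) B2ev])
  then show "B \<in> sets (graph_process n)" by (simp only: B)
  have Dp: "prob (?D v) \<le> exp 8 * exp (- rate * real i) / sqrt (real i)" if v: "v < n" for v
  proof -
    have "prob (?D v) = (\<Sum>k | k \<le> n - 1 \<and> k \<le> K. Bernstein (n - 1) k p0)"
      by (rule gp_degree_prob[OF v p0])
    also have "\<dots> \<le> (\<Sum>k\<le>K. Bernstein (n - 1) k p0)"
      using Bernstein_nonneg[OF p0] by (intro sum_mono2) auto
    also have "\<dots> \<le> exp 8 * exp (- rate * real i) / sqrt (real i)"
      unfolding p0_def N(2) using n i N by (intro Bernstein_lower_tail) (auto simp: K_def N_def)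
    finally show ?thesis .
  qed
  have "prob ?B2 \<le> (\<Sum>v\<in>{..<n}. prob (?D v))"
    unfolding B2 using D by (intro finite_measure_subadditive_finite) auto
  also have "\<dots> \<le> (\<Sum>v\<in>{..<n}. exp 8 * exp (- rate * real i) / sqrt (real i))"
    by (intro sum_mono Dp) simp
  also have "\<dots> = real n * (exp 8 * exp (- rate * real i) / sqrt (real i))" by simp
  finally have B2p: "prob ?B2 \<le> real n * (exp 8 * exp (- rate * real i) / sqrt (real i))" .
  have "real n * real (Suc i) / (2 * (N/2)\<^sup>2) \<le> (2 * N) * real (Suc i) / (2 * (N/2)\<^sup>2)"
    using n by (intro divide_right_mono mult_right_mono) (auto simp: N_def)
  also have "\<dots> = 4 * (real i + 1) / N" using N(1) by (simp add: power2_eq_square field_simps)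
  finally have "prob ?B1 \<le> 4 * (real i + 1) / N" using dev(2) by linarith
  then show "measure (graph_process n) B \<le> 4 * (real i + 1) / N + real n * (exp 8 * exp (- rate * real i) / sqrt (real i))"
    using measure_Un_le[OF dev(1) B2ev] B2p unfolding B by linarith
  show "real (gp_mindeg n P p) > real (gp_edges n P p) / N"
    if P: "P \<in> space (graph_process n)" "P \<notin> B" and p: "real i / N \<le> p" "p \<le> (real i + 1) / N"
  proof (rule gp_mindeg_gt)
    fix v assume v: "v < n"
    have "K < gp_degree n P p0 v" using P v unfolding B by blast
    also have "\<dots> \<le> gp_degree n P p v" using p v by (intro gp_degree_mono) (simp_all add: p0_def)
    finally have d: "K + 1 \<le> gp_degree n P p v" by simp
    have "i + 5 \<le> 2 * (K + 1)" unfolding K_def by presburger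
    also have "\<dots> \<le> 2 * gp_degree n P p v" by (rule mult_le_mono2[OF d])
    finally have "i + 5 \<le> 2 * gp_degree n P p v" .
    then have "real (i + 5) \<le> real (2 * gp_degree n P p v)" by (simp only: of_nat_le_iff)
    then have "real i + 5 \<le> 2 * real (gp_degree n P p v)" by simp
    then have 1: "(real i + 5) * N \<le> 2 * real (gp_degree n P p v) * N" using N by (intro mult_right_mono) auto
    have "\<bar>real (gp_edges n P (real (Suc i) / N)) - real n * real (Suc i) / 2\<bar> < N / 2" using P unfolding B by auto
    moreover have "real (gp_edges n P p) \<le> real (gp_edges n P (real (Suc i) / N))"
      using p by (simp add: gp_edges_mono add.commute)
    ultimately have "2 * real (gp_edges n P p) < real n * real (Suc i) + N" by linarith
    also have "real n * real (Suc i) + N = (real i + 2) * N + real (Suc i)" by (simp add: N_def algebra_simps)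
    also have "\<dots> \<le> (real i + 2) * N + N" using iN by simp
    also have "\<dots> \<le> (real i + 5) * N" using N by (simp add: algebra_simps)
    finally have "real (gp_edges n P p) < real (gp_degree n P p v) * N" using 1 by linarith
    then show "real (gp_degree n P p v) > real (gp_edges n P p) / N"
      using N(1) by (simp add: divide_less_eq)
  qed (use n in auto)
qed

lemma sum_powers_from:
  fixes r :: real
  assumes "0 \<le> r" "r < 1" "finite I" "\<And>i. i \<in> I \<Longrightarrow> m \<le> i"
  shows "(\<Sum>i\<in>I. r ^ i) \<le> r ^ m / (1 - r)"
proof -
  have s: "summable (\<lambda>i. r ^ (i + m))" using assms by (simp add: power_add summable_mult2 summable_geometric)
  have "(\<Sum>i\<in>I. r ^ i) = (\<Sum>j\<in>(\<lambda>i. i - m) ` I. r ^ (j + m))"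
    using assms(4) by (subst sum.reindex) (auto intro!: sum.cong inj_onI simp: eq_diff_iff)
  also have "\<dots> \<le> (\<Sum>j. r ^ (j + m))" using assms s by (intro sum_le_suminf) auto
  also have "\<dots> = r ^ m / (1 - r)"
    using assms by (simp add: power_add suminf_mult2[symmetric] suminf_geometric summable_geometric)
  finally show ?thesis .
qed

text \<open>Now the first cell dominates, since the vertex terms decay with ratio
  \<open>exp (- rate)\<close>; the factor \<open>exp rate\<close> appears because that cell may
  start as low as \<open>x - 1\<close>. The cap \<open>y\<close> keeps every cell in the range
  \<open>i\<^sup>2 \<le> N\<close> of the Poisson comparison, and \<open>x \<ge> 9\<close> ensures
  \<open>i \<ge> 8\<close>.\<close>

lemma supercritical_bound:
  fixes x y :: real
  assumes n: "n \<ge> 2" and x: "x \<ge> 9" and y: "y\<^sup>2 \<le> real n - 1" "y \<ge> 0"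
  shows "measure (graph_process n) {P \<in> space (graph_process n). \<forall>p\<in>{0..1}.
      x / (real n - 1) \<le> p \<longrightarrow> p \<le> y / (real n - 1) \<longrightarrow> real (gp_mindeg n P p) > gp_avgdeg n P p / 2}
    \<ge> 1 - (4 * (y + 1)\<^sup>2 / (real n - 1) +
       exp 8 * exp rate / (1 - exp (- rate)) * (real n * exp (- rate * x) / sqrt (x - 1)))"
proof -
  interpret prob_space "graph_process n" by (rule prob_space_graph_process)
  define N where "N = real n - 1"
  have N: "N \<ge> 1" using n by (simp add: N_def)
  define I where "I = {i. x - 1 \<le> real i \<and> real i \<le> y}"
  have Isub: "I \<subseteq> {..nat \<lfloor>y\<rfloor>}" by (auto simp: I_def le_nat_floor)
  have finI: "finite I" using Isub finite_subset by blast
  let ?c = "\<lambda>i. 4 * (real i + 1) / N + real n * (exp 8 * exp (- rate * real i) / sqrt (real i))"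
  let ?E = "{P \<in> space (graph_process n). \<forall>p\<in>{0..1}.
      x / (real n - 1) \<le> p \<longrightarrow> p \<le> y / (real n - 1) \<longrightarrow> real (gp_mindeg n P p) > gp_avgdeg n P p / 2}"
  let ?B = "\<lambda>i. {P \<in> space (graph_process n). \<bar>real (gp_edges n P (real (Suc i) / N)) - real n * real (Suc i) / 2\<bar> \<ge> N / 2} \<union>
     {P \<in> space (graph_process n). \<not> (\<forall>v<n. gp_degree n P (real i / N) v > i div 2 + 2)}"
  have cond: "i \<ge> 8" "(real i)\<^sup>2 \<le> real n - 1" if "i \<in> I" for i
  proof -
    show "i \<ge> 8" using that x by (simp add: I_def)
    have "(real i)\<^sup>2 \<le> y\<^sup>2" using that by (intro power_mono) (auto simp: I_def)
    then show "(real i)\<^sup>2 \<le> real n - 1" using y by linarith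
  qed
  note low = grid_no_low_vertex[OF n cond, folded N_def]
  have "prob ?E \<ge> 1 - (\<Sum>i\<in>I. ?c i)"
  proof (rule prob_ge_one_minus[where B = ?B, OF _ finI])
    show "?E \<in> events"
      using gp_range_event_sets(2)[where lo = "x / (real n - 1)" and hi = "y / (real n - 1)" and c = "1/2" and n = n] by simp
    fix i assume i: "i \<in> I"
    show "?B i \<in> events" "prob (?B i) \<le> ?c i" using low(1,2)[OF i i] .
  next
    fix P assume P: "P \<in> space (graph_process n)" "\<And>i. i \<in> I \<Longrightarrow> P \<notin> ?B i"
    show "P \<in> ?E"
    proof (intro CollectI conjI ballI impI P)
      fix p :: real assume p: "p \<in> {0..1}" "x / (real n - 1) \<le> p" "p \<le> y / (real n - 1)"
      obtain i where i: "real i / N \<le> p" "p \<le> (real i + 1) / N" "real i \<le> N * p" "N * p < real i + 1"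
        using floor_grid[of N p] N p by auto
      have "N * p \<le> y" "x \<le> N * p" using p N by (simp_all add: N_def field_simps)
      then have I: "i \<in> I" using i unfolding I_def by auto
      have "real (gp_mindeg n P p) > real (gp_edges n P p) / N"
        using low(3)[OF I I P(1) P(2)[OF I] i(1,2)] .
      then show "real (gp_mindeg n P p) > gp_avgdeg n P p / 2" by (simp add: gp_avgdeg_def flip: N_def)
    qed
  qed
  moreover have "(\<Sum>i\<in>I. ?c i) \<le> 4 * (y + 1)\<^sup>2 / N + exp 8 * exp rate / (1 - exp (- rate)) * (real n * exp (- rate * x) / sqrt (x - 1))"
  proof -
    have cI: "real (card I) \<le> y + 1"
    proof -
      have "card I \<le> card {..nat \<lfloor>y\<rfloor>}" using Isub by (intro card_mono) auto
      then show ?thesis using y(2) by (simp add: nat_le_iff le_floor_iff) linarith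
    qed
    have "(\<Sum>i\<in>I. 4 * (real i + 1) / N) \<le> (\<Sum>i\<in>I. 4 * (y + 1) / N)"
      using N by (intro sum_mono divide_right_mono) (auto simp: I_def)
    also have "\<dots> = real (card I) * (4 * (y + 1) / N)" by simp
    also have "\<dots> \<le> (y + 1) * (4 * (y + 1) / N)" using cI N y by (intro mult_right_mono) auto
    also have "\<dots> = 4 * (y + 1)\<^sup>2 / N" by (simp add: power2_eq_square)
    finally have 1: "(\<Sum>i\<in>I. 4 * (real i + 1) / N) \<le> 4 * (y + 1)\<^sup>2 / N" .
    have r: "exp (- rate) < 1" "0 \<le> exp (- rate)" using rate_pos by auto
    define m where "m = nat \<lceil>x - 1\<rceil>"
    have m: "x - 1 \<le> real m" using x by (simp add: m_def) 
    have mI: "m \<le> i" if "i \<in> I" for i 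
      using that unfolding m_def nat_ceiling_le_eq by (simp add: I_def)
    have "(\<Sum>i\<in>I. real n * (exp 8 * exp (- rate * real i) / sqrt (real i))) \<le>
        (\<Sum>i\<in>I. real n * exp 8 / sqrt (x - 1) * exp (- rate) ^ i)"
    proof (rule sum_mono)
      fix i assume i: "i \<in> I"
      have "exp (- rate * real i) = exp (- rate) ^ i" by (simp add: mult.commute flip: exp_of_nat_mult)
      moreover have "exp 8 * exp (- rate) ^ i / sqrt (real i) \<le> exp 8 * exp (- rate) ^ i / sqrt (x - 1)"
        using i x by (intro divide_left_mono) (auto simp: I_def)
      then have "real n * (exp 8 * exp (- rate) ^ i / sqrt (real i)) \<le> real n * (exp 8 * exp (- rate) ^ i / sqrt (x - 1))"
        by (rule mult_left_mono) simp
      ultimately show "real n * (exp 8 * exp (- rate * real i) / sqrt (real i)) \<le> real n * exp 8 / sqrt (x - 1) * exp (- rate) ^ i"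
        by (simp add: mult_ac)
    qed
    also have "\<dots> = real n * exp 8 / sqrt (x - 1) * (\<Sum>i\<in>I. exp (- rate) ^ i)" by (simp add: sum_distrib_left)
    also have "\<dots> \<le> real n * exp 8 / sqrt (x - 1) * (exp (- rate) ^ m / (1 - exp (- rate)))"
      using x r mI finI by (intro mult_left_mono sum_powers_from) auto
    also have "exp (- rate) ^ m \<le> exp rate * exp (- rate * x)"
    proof -
      have "exp (- rate) ^ m = exp (- rate * real m)" by (simp add: mult.commute flip: exp_of_nat_mult)
      also have "\<dots> \<le> exp (- rate * (x - 1))" using m rate_pos by simp
      finally show ?thesis by (simp add: algebra_simps flip: exp_add)
    qed
    also have "real n * exp 8 / sqrt (x - 1) * (exp rate * exp (- rate * x) / (1 - exp (- rate))) =
       exp 8 * exp rate / (1 - exp (- rate)) * (real n * exp (- rate * x) / sqrt (x - 1))" by (simp add: mult_ac)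
    finally have 2: "(\<Sum>i\<in>I. real n * (exp 8 * exp (- rate * real i) / sqrt (real i))) \<le>
       exp 8 * exp rate / (1 - exp (- rate)) * (real n * exp (- rate * x) / sqrt (x - 1))"
      using x r by (simp add: mult_left_mono divide_right_mono)
    show ?thesis unfolding sum.distrib using 1 2 by (rule add_mono)
  qed
  ultimately show ?thesis unfolding N_def by linarith
qed

section \<open>Concentration up to the end of the process\<close>

text \<open>This is the exponent in Chernoff's bound for falling below \<open>a\<close> times the
  mean. Its positivity is the strictness of \<open>ln y \<le> y - 1\<close> at
  \<open>y = 1 / a\<close>.\<close>

lemma chernoff_rate_pos:
  fixes a :: real
  assumes "0 < a" "a < 1"
  shows "1 - a + a * ln a > 0"
proof -
  have "ln (1 / a) < 1 / a - 1"
    using ln_le_minus_one[of "1 / a"] ln_eq_minus_one[of "1 / a"] assms by fastforce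
  then have "a * ln (1 / a) < a * (1 / a - 1)" using assms by (intro mult_strict_left_mono) auto
  then show ?thesis using assms by (simp add: ln_div algebra_simps)
qed

text \<open>The tolerance for the edge count is now proportional to its mean, so that Chebyshev's
  bound is of order \<open>1 / (i * N)\<close> and survives a sum over about \<open>N\<close> cells.
  The hypothesis \<open>fit\<close> compares the upper bound for the edges at the right end with the
  degree bound \<open>a * i\<close> at the left end.\<close>

lemma grid_concentrated:
  fixes a s \<theta> :: real
  assumes n: "n \<ge> 2" and i: "i < n - 1" "i \<ge> 1" and a: "0 < a" "a < 1" and s: "s > 0" and \<theta>: "\<theta> > 0"
    and fit: "real n * (real i + 1) / 2 + s * real i * (real n - 1) \<le> a / (2 * \<theta>) * real i * (real n - 1)"
  defines "N \<equiv> real n - 1"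
  defines "B \<equiv> {P \<in> space (graph_process n). \<bar>real (gp_edges n P (real (Suc i) / N)) - real n * real (Suc i) / 2\<bar> \<ge> s * real i * N} \<union>
     {P \<in> space (graph_process n). \<not> (\<forall>v<n. real (gp_degree n P (real i / N) v) > a * real i)}"
  shows "B \<in> sets (graph_process n)"
    and "measure (graph_process n) B \<le> 2 / (s\<^sup>2 * real i * N) + real n * exp (- (1 - a + a * ln a) * real i)"
    and "P \<in> space (graph_process n) \<Longrightarrow> P \<notin> B \<Longrightarrow> real i / N \<le> p \<Longrightarrow> p \<le> (real i + 1) / N \<Longrightarrow>
       real (gp_mindeg n P p) > \<theta> * gp_avgdeg n P p"
proof -
  interpret prob_space "graph_process n" by (rule prob_space_graph_process)
  have N: "N \<ge> 1" "N = real (n - 1)" using n by (auto simp: N_def)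
  define p0 where "p0 = real i / N"
  have iN: "real i \<le> N" "real (Suc i) \<le> N" using i N by simp_all
  then have iN': "real (Suc i) \<le> real n - 1" by (simp add: N_def)
  have p0: "0 \<le> p0" "p0 \<le> 1" using iN N by (auto simp: p0_def)
  have N2: "s * real i * N > 0" using N s i by simp
  note dev = grid_edges_deviation[OF n iN' N2, folded N_def]
  let ?B1 = "{P \<in> space (graph_process n). \<bar>real (gp_edges n P (real (Suc i) / N)) - real n * real (Suc i) / 2\<bar> \<ge> s * real i * N}"
  let ?B2 = "{P \<in> space (graph_process n). \<not> (\<forall>v<n. real (gp_degree n P p0 v) > a * real i)}"
  let ?D = "\<lambda>v. {P \<in> space (graph_process n). real (gp_degree n P p0 v) \<le> a * real i}"
  have B: "B = ?B1 \<union> ?B2" by (simp add: B_def p0_def)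
  have B2: "?B2 = (\<Union>v\<in>{..<n}. ?D v)" by (auto simp: not_less)
  have D: "?D v \<in> events" if "v < n" for v by (rule gp_degree_event_sets[OF that p0])
  have B2ev: "?B2 \<in> events" unfolding B2 using D by (intro sets.finite_UN) auto
  have "?B1 \<union> ?B2 \<in> events" by (rule sets.Un[OF dev(1) B2ev])
  then show "B \<in> sets (graph_process n)" by (simp only: B)
  have Dp: "prob (?D v) \<le> exp (- (1 - a + a * ln a) * real i)" if v: "v < n" for v
  proof -
    have "prob (?D v) = (\<Sum>k | k \<le> n - 1 \<and> real k \<le> a * real i. Bernstein (n - 1) k p0)"
      by (rule gp_degree_prob[OF v p0])
    \<comment> \<open>\<open>t = - ln a\<close> is the optimal parameter; it makes
      \<open>exp (- t) = a\<close>.\<close>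
    also have "\<dots> \<le> exp ((- ln a) * (a * real i) - real (n - 1) * p0 * (1 - exp (- (- ln a))))"
      using a by (intro Bernstein_chernoff p0) simp
    also have "real (n - 1) * p0 = real i" using N by (simp add: p0_def)
    also have "(- ln a) * (a * real i) - real i * (1 - exp (- (- ln a))) = - (1 - a + a * ln a) * real i"
      using a by (simp add: algebra_simps)
    finally show ?thesis .
  qed
  have "prob ?B2 \<le> (\<Sum>v\<in>{..<n}. prob (?D v))"
    unfolding B2 using D by (intro finite_measure_subadditive_finite) auto
  also have "\<dots> \<le> (\<Sum>v\<in>{..<n}. exp (- (1 - a + a * ln a) * real i))"
    by (intro sum_mono Dp) simp
  also have "\<dots> = real n * exp (- (1 - a + a * ln a) * real i)" by simp
  finally have B2p: "prob ?B2 \<le> real n * exp (- (1 - a + a * ln a) * real i)" .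
  have "real n * real (Suc i) \<le> (2 * N) * (2 * real i)"
    using n i by (intro mult_mono) (auto simp: N_def)
  then have "real n * real (Suc i) / (2 * (s * real i * N)\<^sup>2) \<le> (2 * N) * (2 * real i) / (2 * (s * real i * N)\<^sup>2)"
    by (rule divide_right_mono) simp
  also have "\<dots> = 2 / (s\<^sup>2 * real i * N)" using N(1) s i by (simp add: power2_eq_square field_simps)
  finally have "prob ?B1 \<le> 2 / (s\<^sup>2 * real i * N)" using dev(2) by linarith
  then show "measure (graph_process n) B \<le> 2 / (s\<^sup>2 * real i * N) + real n * exp (- (1 - a + a * ln a) * real i)"
    using measure_Un_le[OF dev(1) B2ev] B2p unfolding B by linarith
  show "real (gp_mindeg n P p) > \<theta> * gp_avgdeg n P p"
    if P: "P \<in> space (graph_process n)" "P \<notin> B" and p: "real i / N \<le> p" "p \<le> (real i + 1) / N"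
  proof (rule gp_mindeg_gt)
    fix v assume v: "v < n"
    have d: "a * real i < real (gp_degree n P p0 v)" using P v unfolding B by blast
    have d': "gp_degree n P p0 v \<le> gp_degree n P p v" using p v by (intro gp_degree_mono) (simp_all add: p0_def)
    have "\<bar>real (gp_edges n P (real (Suc i) / N)) - real n * real (Suc i) / 2\<bar> < s * real i * N" using P unfolding B by auto
    moreover have "real (gp_edges n P p) \<le> real (gp_edges n P (real (Suc i) / N))"
      using p by (simp add: gp_edges_mono add.commute)
    ultimately have "real (gp_edges n P p) < real n * (real i + 1) / 2 + s * real i * N" by (simp add: abs_less_iff algebra_simps)
    also have "\<dots> \<le> a / (2 * \<theta>) * real i * N" using fit by (simp add: N_def)
    finally have "2 * \<theta> * real (gp_edges n P p) < 2 * \<theta> * (a / (2 * \<theta>) * real i * N)"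
      using \<theta> by (intro mult_strict_left_mono) auto
    also have "\<dots> = a * real i * N" using \<theta> by simp
    finally have "\<theta> * gp_avgdeg n P p < a * real i"
      unfolding gp_avgdeg_def using N(1) by (simp add: divide_less_eq mult_ac flip: N_def)
    then show "real (gp_degree n P p v) > \<theta> * gp_avgdeg n P p" using d d' by linarith
  qed (use n in auto)
qed

text \<open>No geometric decay is used: the at most \<open>N\<close> cells contribute
  \<open>N\<close> times an edge bound of order \<open>1 / (x * N)\<close>, and \<open>N * n\<close>
  times the largest Chernoff bound.\<close>

lemma concentrated_bound:
  fixes x a s \<theta> :: real
  assumes n: "n \<ge> 2" and x: "x \<ge> 2" and a: "0 < a" "a < 1" and s: "s > 0" and \<theta>: "\<theta> > 0"
    and fit: "\<And>i. i < n - 1 \<Longrightarrow> x - 1 \<le> real i \<Longrightarrow>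
      real n * (real i + 1) / 2 + s * real i * (real n - 1) \<le> a / (2 * \<theta>) * real i * (real n - 1)"
  shows "measure (graph_process n) {P \<in> space (graph_process n). \<forall>p\<in>{0..1}.
      x / (real n - 1) \<le> p \<longrightarrow> real (gp_mindeg n P p) > \<theta> * gp_avgdeg n P p}
    \<ge> 1 - (2 / (s\<^sup>2 * (x - 1)) + (real n)\<^sup>2 * exp (- (1 - a + a * ln a) * (x - 1)))"
proof -
  interpret prob_space "graph_process n" by (rule prob_space_graph_process)
  define N where "N = real n - 1"
  have N: "N \<ge> 1" "real (n - 1) = N" using n by (simp_all add: N_def)
  define I where "I = {i. i < n - 1 \<and> x - 1 \<le> real i}"
  have finI: "finite I" by (simp add: I_def)
  let ?r = "1 - a + a * ln a"
  have r: "?r > 0" using chernoff_rate_pos[OF a] .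
  let ?c = "\<lambda>i. 2 / (s\<^sup>2 * real i * N) + real n * exp (- ?r * real i)"
  let ?E = "{P \<in> space (graph_process n). \<forall>p\<in>{0..1}.
      x / (real n - 1) \<le> p \<longrightarrow> real (gp_mindeg n P p) > \<theta> * gp_avgdeg n P p}"
  let ?B = "\<lambda>i. {P \<in> space (graph_process n). \<bar>real (gp_edges n P (real (Suc i) / N)) - real n * real (Suc i) / 2\<bar> \<ge> s * real i * N} \<union>
     {P \<in> space (graph_process n). \<not> (\<forall>v<n. real (gp_degree n P (real i / N) v) > a * real i)}"
  have cond: "i < n - 1" "i \<ge> 1" "x - 1 \<le> real i" if "i \<in> I" for i using that x by (auto simp: I_def)
  note low = grid_concentrated[OF n cond(1,2) a s \<theta> fit[OF cond(1,3)], folded N_def]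
  have "prob ?E \<ge> 1 - (\<Sum>i\<in>I. ?c i)"
  proof (rule prob_ge_one_minus[where B = ?B, OF _ finI])
    have "?E = {P \<in> space (graph_process n). \<forall>p\<in>{0..1}.
      x / (real n - 1) \<le> p \<longrightarrow> p \<le> 1 \<longrightarrow> real (gp_mindeg n P p) > \<theta> * gp_avgdeg n P p}" by auto
    then show "?E \<in> events" by (simp only: gp_range_event_sets(2))
    fix i assume i: "i \<in> I"
    show "?B i \<in> events" "prob (?B i) \<le> ?c i" using low(1,2)[OF i i i i] .
  next
    fix P assume P: "P \<in> space (graph_process n)" "\<And>i. i \<in> I \<Longrightarrow> P \<notin> ?B i"
    show "P \<in> ?E"
    proof (intro CollectI conjI ballI impI P)
      fix p :: real assume p: "p \<in> {0..1}" "x / (real n - 1) \<le> p"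
      have xN: "x \<le> N * p" using p N by (simp add: N_def field_simps)
      have pN: "N * p \<le> N" using p N by simp
      obtain i where i: "real i / N \<le> p" "p \<le> (real i + 1) / N" "i \<in> I"
      proof (cases "p = 1")
        \<comment> \<open>The floor would select a cell that starts at 1 and leaves the unit
          interval; the cell that ends at 1 is taken instead.\<close>
        case True
        have "n \<ge> 3" using xN x True N_def by auto
        then have "real (n - 2) = N - 1" by (simp add: N_def of_nat_diff)
        then show thesis using that[of "n - 2"] True N xN n \<open>n \<ge> 3\<close> by (auto simp: I_def)
      next
        case False
        then have "N * p < N * 1" using p N by (intro mult_strict_left_mono) auto
        moreover obtain i where i: "real i / N \<le> p" "p \<le> (real i + 1) / N" "real i \<le> N * p" "N * p < real i + 1"
          using floor_grid[of N p] N p by auto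
        ultimately have "real i < real (n - 1)" using N by linarith
        then have "i \<in> I" using i xN unfolding I_def by auto
        then show thesis using that i by blast
      qed
      show "real (gp_mindeg n P p) > \<theta> * gp_avgdeg n P p"
        using low(3)[OF i(3) i(3) i(3) i(3) P(1) P(2)[OF i(3)] i(1,2)] .
    qed
  qed
  moreover have "(\<Sum>i\<in>I. ?c i) \<le> 2 / (s\<^sup>2 * (x - 1)) + (real n)\<^sup>2 * exp (- ?r * (x - 1))"
  proof -
    have "card I \<le> card {..<n - 1}" by (intro card_mono) (auto simp: I_def)
    then have cI: "real (card I) \<le> N" using N by simp
    have "(\<Sum>i\<in>I. ?c i) \<le> (\<Sum>i\<in>I. 2 / (s\<^sup>2 * (x - 1) * N) + real n * exp (- ?r * (x - 1)))"
    proof (intro sum_mono add_mono)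
      fix i assume i: "i \<in> I"
      have xi: "x - 1 \<le> real i" by (rule cond[OF i])
      then have "s\<^sup>2 * (x - 1) * N \<le> s\<^sup>2 * real i * N" using N by (intro mult_right_mono mult_left_mono) auto
      moreover have "0 < s\<^sup>2 * (x - 1) * N" using s x N by simp
      ultimately show "2 / (s\<^sup>2 * real i * N) \<le> 2 / (s\<^sup>2 * (x - 1) * N)" by (intro divide_left_mono) auto
      have "- ?r * real i \<le> - ?r * (x - 1)" using xi r by (intro mult_left_mono_neg) auto
      then show "real n * exp (- ?r * real i) \<le> real n * exp (- ?r * (x - 1))" by (intro mult_left_mono) auto
    qed
    also have "\<dots> = real (card I) * (2 / (s\<^sup>2 * (x - 1) * N) + real n * exp (- ?r * (x - 1)))" by simp
    also have "\<dots> \<le> N * (2 / (s\<^sup>2 * (x - 1) * N) + real n * exp (- ?r * (x - 1)))"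
      using cI x N by (intro mult_right_mono) auto
    also have "\<dots> = 2 / (s\<^sup>2 * (x - 1)) + N * real n * exp (- ?r * (x - 1))"
      using N(1) by (subst distrib_left) simp
    also have "\<dots> \<le> 2 / (s\<^sup>2 * (x - 1)) + (real n)\<^sup>2 * exp (- ?r * (x - 1))"
      unfolding power2_eq_square by (intro add_left_mono mult_right_mono) (auto simp: N_def)
    finally show ?thesis .
  qed
  ultimately show ?thesis by linarith
qed

lemma prob_tendsto_one:
  assumes "eventually (\<lambda>n. measure (graph_process n) (E n) \<ge> 1 - f n) sequentially" "f \<longlonglongrightarrow> 0"
  shows "(\<lambda>n. measure (graph_process n) (E n)) \<longlonglongrightarrow> 1"
proof (rule tendsto_sandwich[OF assms(1)])
  show "eventually (\<lambda>n. measure (graph_process n) (E n) \<le> 1) sequentially"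
    using prob_space.prob_le_1[OF prob_space_graph_process] by auto
  show "(\<lambda>n. 1 - f n) \<longlonglongrightarrow> 1" using tendsto_diff[OF tendsto_const assms(2), of 1] by simp
qed simp

lemma concentrated_limit:
  fixes \<theta> :: real
  assumes "0 < \<theta>" "\<theta> < 1"
  obtains \<rho> f where "\<rho> > 0" "f \<longlonglongrightarrow> 0"
    "eventually (\<lambda>n. measure (graph_process n) {P \<in> space (graph_process n). \<forall>p\<in>{0..1}.
       \<rho> * ln (real n) / (real n - 1) \<le> p \<longrightarrow> real (gp_mindeg n P p) > \<theta> * gp_avgdeg n P p} \<ge> 1 - f n) sequentially"
proof -
  \<comment> \<open>Any value strictly between \<open>\<theta>\<close> and 1 would serve: degrees
    stay above \<open>a\<close> times the mean degree, and the average degree stays below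
    \<open>a / \<theta>\<close> times it.\<close>
  define a where "a = (1 + \<theta>) / 2"
  have a: "0 < a" "a < 1" "\<theta> < a" using assms by (auto simp: a_def)
  define r where "r = 1 - a + a * ln a"
  have r: "r > 0" using chernoff_rate_pos[OF a(1,2)] by (simp add: r_def)
  \<comment> \<open>\<open>\<kappa>\<close> is the relative room for the edge count above its mean.
    The choice \<open>s = \<kappa> / 4\<close> spends half of it on the random deviation; the other
    half covers the change across a cell.\<close>
  define \<kappa> where "\<kappa> = a / \<theta> - 1"
  have \<kappa>: "\<kappa> > 0" using assms a by (simp add: \<kappa>_def)
  define s where "s = \<kappa> / 4"
  have s: "s > 0" using \<kappa> by (simp add: s_def)
  \<comment> \<open>With \<open>r * \<rho> = 3\<close> the degree term, which carries the factor
    \<open>n\<^sup>2\<close>, is of order \<open>1 / n\<close>.\<close>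
  define \<rho> where "\<rho> = 3 / r"
  have \<rho>: "\<rho> > 0" using r by (simp add: \<rho>_def)
  define f where "f = (\<lambda>n. 2 / (s\<^sup>2 * (\<rho> * ln (real n) - 1)) + (real n)\<^sup>2 * exp (- r * (\<rho> * ln (real n) - 1)))"
  have "f \<longlonglongrightarrow> 0"
  proof -
    have "(\<lambda>n::nat. 2 / (s\<^sup>2 * (\<rho> * ln (real n) - 1))) \<longlonglongrightarrow> 0" using s \<rho> by real_asymp
    moreover have "(\<lambda>n::nat. (real n)\<^sup>2 * exp (- r * (\<rho> * ln (real n) - 1))) \<longlonglongrightarrow> 0"
    proof (rule Lim_transform_eventually)
      show "(\<lambda>n::nat. (real n)\<^sup>2 * exp (r - 3 * ln (real n))) \<longlonglongrightarrow> 0" by real_asymp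
      show "\<forall>\<^sub>F n in sequentially. (real n)\<^sup>2 * exp (r - 3 * ln (real n)) = (real n)\<^sup>2 * exp (- r * (\<rho> * ln (real n) - 1))"
        using r by (simp add: \<rho>_def algebra_simps)
    qed
    ultimately show ?thesis unfolding f_def using tendsto_add[of _ 0 _ _ 0] by simp
  qed
  \<comment> \<open>The number \<open>2 + 8 / \<kappa>\<close> yields
    \<open>8 \<le> \<kappa> * real i\<close> and \<open>8 \<le> \<kappa> * N\<close>, which makes
    the rounding terms at most \<open>t / 4\<close>.\<close>
  have ev: "eventually (\<lambda>n. \<rho> * ln (real n) \<ge> 2 + 8 / \<kappa>) sequentially" using \<rho> by real_asymp
  have ev2: "eventually (\<lambda>n. real n - 1 \<ge> 2 + 8 / \<kappa>) sequentially" by real_asymp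
  have "eventually (\<lambda>n. measure (graph_process n) {P \<in> space (graph_process n). \<forall>p\<in>{0..1}.
       \<rho> * ln (real n) / (real n - 1) \<le> p \<longrightarrow> real (gp_mindeg n P p) > \<theta> * gp_avgdeg n P p} \<ge> 1 - f n) sequentially"
    using ev ev2
  proof eventually_elim
    case (elim n)
    have k0: "8 / \<kappa> > 0" using \<kappa> by simp
    show ?case unfolding f_def r_def
    proof (rule concentrated_bound[OF _ _ a(1,2) s assms(1)])
      show "2 \<le> n" using elim k0 by linarith
      show "2 \<le> \<rho> * ln (real n)" using elim k0 by linarith
      fix i assume i: "\<rho> * ln (real n) - 1 \<le> real i"
      define N where "N = real n - 1"
      have b: "1 + 8 / \<kappa> \<le> real i" "1 + 8 / \<kappa> \<le> N" using i elim unfolding N_def by linarith+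
      then have i1: "1 \<le> real i" "1 \<le> N" using k0 by linarith+
      have "8 \<le> \<kappa> * real i" "8 \<le> \<kappa> * N" using b \<kappa> by (simp_all add: field_simps)
      define t where "t = \<kappa> * real i * N"
      have t: "8 * N \<le> t" "8 * real i \<le> t"
        using mult_right_mono[OF \<open>8 \<le> \<kappa> * real i\<close>, of N] mult_right_mono[OF \<open>8 \<le> \<kappa> * N\<close>, of "real i"] i1
        by (simp_all add: t_def mult_ac)
      have "(N + 1) * (real i + 1) / 2 + s * real i * N = (real i * N + N + real i + 1) / 2 + t / 4"
        by (simp add: s_def t_def algebra_simps)
      also have "\<dots> = real i * N / 2 + (N + real i + 1) / 2 + t / 4" by (simp add: add_divide_distrib)
      also have "\<dots> \<le> real i * N / 2 + t / 4 + t / 4"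
      proof -
        have "N + real i + 1 \<le> t / 2" using t i1 by linarith
        then have "(N + real i + 1) / 2 \<le> t / 4" using divide_right_mono[of _ "t / 2" 2] by simp
        then show ?thesis by (intro add_mono order_refl)
      qed
      also have "\<dots> = t / 2 + real i * N / 2" by simp
      also have "\<dots> = (\<kappa> + 1) / 2 * real i * N" by (simp add: t_def algebra_simps)
      finally have "(N + 1) * (real i + 1) / 2 + s * real i * N \<le> (\<kappa> + 1) / 2 * real i * N" .
      moreover have "(\<kappa> + 1) / 2 = a / (2 * \<theta>)" by (simp add: \<kappa>_def)
      ultimately show "real n * (real i + 1) / 2 + s * real i * (real n - 1) \<le> a / (2 * \<theta>) * real i * (real n - 1)"
        by (simp add: N_def)
    qed
  qed
  then show thesis using that \<rho> \<open>f \<longlonglongrightarrow> 0\<close> by blast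
qed

section \<open>The threshold\<close>

lemma rate_inverse: "2 / ln (exp 1 / 2) = 1 / rate"
  by (simp add: rate_def ln_div)

theorem theorem7p1:
  fixes w :: "nat \<Rightarrow> real"
  assumes w: "filterlim w at_top sequentially"
  defines "\<beta> \<equiv> 2 / ln (exp 1 / 2)"
  shows
   "((\<lambda>n. measure (graph_process n)
        {P \<in> space (graph_process n). \<forall>p\<in>{0..1}.
           p \<le> (\<beta> * (ln (real n) - ln (ln (real n)) / 2) - w n) / (real n - 1) \<longrightarrow>
           real (gp_mindeg n P p) \<le> gp_avgdeg n P p / 2}) \<longlonglongrightarrow> 1)
  \<and> ((\<lambda>n. measure (graph_process n)
        {P \<in> space (graph_process n). \<forall>p\<in>{0..1}.
           p \<ge> (\<beta> * (ln (real n) - ln (ln (real n)) / 2) + w n) / (real n - 1) \<longrightarrow>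
           real (gp_mindeg n P p) > gp_avgdeg n P p / 2}) \<longlonglongrightarrow> 1)
  \<and> (\<forall>\<theta>::real. 0 < \<theta> \<and> \<theta> < 1 \<longrightarrow> (\<exists>\<rho>::real. \<rho> > 0 \<and>
        ((\<lambda>n. measure (graph_process n)
          {P \<in> space (graph_process n). \<forall>p\<in>{0..1}.
             \<rho> * ln (real n) / (real n - 1) \<le> p \<longrightarrow>
             real (gp_mindeg n P p) > \<theta> * gp_avgdeg n P p}) \<longlonglongrightarrow> 1)))"
proof (intro conjI allI impI)
  have \<beta>: "\<beta> = 1 / rate" "\<beta> > 0" "rate * \<beta> = 1" using rate_pos by (simp_all add: \<beta>_def rate_inverse)
  \<comment> \<open>This yields \<open>x - 1 \<ge> ln n\<close> above the threshold, where
    \<open>sqrt (x - 1)\<close> has to absorb \<open>sqrt (ln n)\<close>.\<close>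
  have \<beta>2: "\<beta> \<ge> 2" 
  proof -
    have "rate * \<beta> \<le> 1/2 * \<beta>" using \<beta>(2) rate_less by (intro mult_right_mono) auto
    then show ?thesis using \<beta>(3) by linarith
  qed
  have w0: "(\<lambda>n. exp (- rate * w n)) \<longlonglongrightarrow> 0"
    using rate_pos
    by (intro filterlim_compose[OF exp_at_bot] filterlim_tendsto_neg_mult_at_bot[OF tendsto_const _ w]) simp
  have w1: "eventually (\<lambda>n. w n \<ge> 1) sequentially" using w by (simp add: filterlim_at_top)
  have nL: "real n = exp (ln (real n))" if "ln (real n) \<ge> 8" for n :: nat
    using that by (cases "n = 0") auto
  have sqL: "exp (ln L / 2) = sqrt L" if "L \<ge> 8" for L :: real
  proof -
    have "ln L / 2 = ln (sqrt L)" using that by (simp add: ln_sqrt)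
    then have "exp (ln L / 2) = exp (ln (sqrt L))" by (rule arg_cong)
    also have "\<dots> = sqrt L" using that by (intro exp_ln) simp
    finally show ?thesis .
  qed
  have L8: "eventually (\<lambda>n. ln (real n) \<ge> 8) sequentially" by real_asymp

  \<comment> \<open>Below the threshold a vertex of low degree exists\<close>
  show "(\<lambda>n. measure (graph_process n)
        {P \<in> space (graph_process n). \<forall>p\<in>{0..1}.
           p \<le> (\<beta> * (ln (real n) - ln (ln (real n)) / 2) - w n) / (real n - 1) \<longrightarrow>
           real (gp_mindeg n P p) \<le> gp_avgdeg n P p / 2}) \<longlonglongrightarrow> 1"
  proof (rule prob_tendsto_one)
    define C where "C = exp 7 * exp (2 * rate) / (exp rate - 1)"
    have C: "C \<ge> 0" using rate_pos by (simp add: C_def)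
    have t1: "(\<lambda>n. 6 * (\<beta> * ln (real n) + 1)\<^sup>2 / (real n - 1)) \<longlonglongrightarrow> 0" using \<beta>(2) by real_asymp
    show "(\<lambda>n. 6 * (\<beta> * ln (real n) + 1)\<^sup>2 / (real n - 1) + C * (sqrt (\<beta> + 1) * exp (- rate * w n))) \<longlonglongrightarrow> 0"
      using tendsto_add[OF t1 tendsto_mult_left[OF tendsto_mult_left[OF w0, of "sqrt (\<beta> + 1)"], of C]] by simp
    have e1: "eventually (\<lambda>n. 4 * (\<beta> * ln (real n) + 1)\<^sup>2 \<le> real n - 1) sequentially" using \<beta>(2) by real_asymp
    show "\<forall>\<^sub>F n in sequentially. 1 - (6 * (\<beta> * ln (real n) + 1)\<^sup>2 / (real n - 1) + C * (sqrt (\<beta> + 1) * exp (- rate * w n)))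
       \<le> measure (graph_process n) {P \<in> space (graph_process n). \<forall>p\<in>{0..1}.
           p \<le> (\<beta> * (ln (real n) - ln (ln (real n)) / 2) - w n) / (real n - 1) \<longrightarrow>
           real (gp_mindeg n P p) \<le> gp_avgdeg n P p / 2}"
      using e1 L8 w1 eventually_ge_at_top[of 2]
    proof eventually_elim
      case (elim n)
      define L where "L = ln (real n)"
      define x where "x = \<beta> * (L - ln L / 2) - w n"
      have L: "L \<ge> 8" "ln L \<ge> 0" using elim by (auto simp: L_def)
      have "\<beta> * (L - ln L / 2) \<le> \<beta> * L" using L \<beta> by (intro mult_left_mono) auto
      then have xL: "x \<le> \<beta> * L" using elim unfolding x_def by linarith
      have n1: "real n - 1 > 0" using elim by simp
      show ?case
      proof (cases "x \<ge> 0")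
        case True
        have x2: "(x + 1)\<^sup>2 \<le> (\<beta> * L + 1)\<^sup>2" using xL True by (intro power_mono) auto
        have "4 * (x + 1)\<^sup>2 \<le> real n - 1" using x2 elim unfolding L_def by linarith
        note bd = subcritical_bound[OF elim(4) this True, folded C_def]
        \<comment> \<open>The origin of the \<open>ln (ln n) / 2\<close> in the threshold: it gives
          \<open>exp (rate * x) = n / sqrt L * exp (- rate * w n)\<close>, whose denominator
          compensates \<open>sqrt (x + 1)\<close>.\<close>
        have "sqrt (x + 1) * exp (rate * x) / real n \<le> sqrt (\<beta> + 1) * exp (- rate * w n)"
        proof -
          have "rate * x = (rate * \<beta>) * (L - ln L / 2) - rate * w n" by (simp add: x_def algebra_simps)
          then have "exp (rate * x) = exp L / exp (ln L / 2) * exp (- rate * w n)"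
            by (simp add: \<beta>(3) flip: exp_diff exp_add)
          also have "\<dots> = real n / sqrt L * exp (- rate * w n)"
            using nL[of n] sqL[OF L(1)] elim by (simp add: L_def)
          finally have ex: "exp (rate * x) = real n / sqrt L * exp (- rate * w n)" .
          have "x + 1 \<le> (\<beta> + 1) * L" using xL L by (simp add: algebra_simps)
          then have "sqrt (x + 1) \<le> sqrt (\<beta> + 1) * sqrt L" by (simp flip: real_sqrt_mult)
          then have "sqrt (x + 1) / sqrt L \<le> sqrt (\<beta> + 1)" using L by (simp add: divide_le_eq)
          then have "sqrt (x + 1) / sqrt L * exp (- rate * w n) \<le> sqrt (\<beta> + 1) * exp (- rate * w n)"
            by (intro mult_right_mono) auto
          moreover have "sqrt (x + 1) * exp (rate * x) / real n = sqrt (x + 1) / sqrt L * exp (- rate * w n)"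
            unfolding ex using elim by simp
          ultimately show ?thesis by simp
        qed
        then have "C * (sqrt (x + 1) * exp (rate * x) / real n) \<le> C * (sqrt (\<beta> + 1) * exp (- rate * w n))"
          using C by (rule mult_left_mono)
        moreover have "6 * (x + 1)\<^sup>2 / (real n - 1) \<le> 6 * (\<beta> * L + 1)\<^sup>2 / (real n - 1)"
          using x2 n1 by (intro divide_right_mono) auto
        ultimately show ?thesis using bd unfolding x_def L_def by linarith
      next
        \<comment> \<open>As \<open>w\<close> may outgrow \<open>ln n\<close>, the bound on
          \<open>p\<close> can be negative, and then no \<open>p\<close> qualifies.\<close>
        case False
        have "{P \<in> space (graph_process n). \<forall>p\<in>{0..1}. p \<le> x / (real n - 1) \<longrightarrow>
           real (gp_mindeg n P p) \<le> gp_avgdeg n P p / 2} = space (graph_process n)"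
        proof -
          have "x / (real n - 1) < 0" using False n1 by (simp add: divide_less_0_iff)
          then show ?thesis by auto
        qed
        then have "measure (graph_process n) {P \<in> space (graph_process n). \<forall>p\<in>{0..1}. p \<le> x / (real n - 1) \<longrightarrow>
           real (gp_mindeg n P p) \<le> gp_avgdeg n P p / 2} = 1"
          using prob_space.prob_space[OF prob_space_graph_process, of n] by simp
        moreover have "0 \<le> 6 * (\<beta> * L + 1)\<^sup>2 / (real n - 1)" "0 \<le> C * (sqrt (\<beta> + 1) * exp (- rate * w n))"
          using C n1 \<beta>(2) by simp_all
        ultimately show ?thesis unfolding x_def L_def by linarith
      qed
    qed
  qed

  \<comment> \<open>Above the threshold all degrees exceed half the average\<close>
  obtain \<rho> g where \<rho>: "\<rho> > 0" and g: "g \<longlonglongrightarrow> 0" and conc: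
    "eventually (\<lambda>n. measure (graph_process n) {P \<in> space (graph_process n). \<forall>p\<in>{0..1}.
       \<rho> * ln (real n) / (real n - 1) \<le> p \<longrightarrow> real (gp_mindeg n P p) > 1/2 * gp_avgdeg n P p} \<ge> 1 - g n) sequentially"
    using concentrated_limit[of "1/2"] by auto
  show "(\<lambda>n. measure (graph_process n)
        {P \<in> space (graph_process n). \<forall>p\<in>{0..1}.
           p \<ge> (\<beta> * (ln (real n) - ln (ln (real n)) / 2) + w n) / (real n - 1) \<longrightarrow>
           real (gp_mindeg n P p) > gp_avgdeg n P p / 2}) \<longlonglongrightarrow> 1"
  proof (rule prob_tendsto_one)
    define C where "C = exp 8 * exp rate / (1 - exp (- rate))"
    have C: "C \<ge> 0" using rate_pos by (simp add: C_def)
    have t1: "(\<lambda>n. 4 * (\<rho> * ln (real n) + 1)\<^sup>2 / (real n - 1)) \<longlonglongrightarrow> 0" using \<rho> by real_asymp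
    show "(\<lambda>n. 4 * (\<rho> * ln (real n) + 1)\<^sup>2 / (real n - 1) + C * exp (- rate * w n) + g n) \<longlonglongrightarrow> 0"
      using tendsto_add[OF tendsto_add[OF t1 tendsto_mult_left[OF w0, of C]] g] by simp
    have e1: "eventually (\<lambda>n. (\<rho> * ln (real n))\<^sup>2 \<le> real n - 1) sequentially" using \<rho> by real_asymp
    show "\<forall>\<^sub>F n in sequentially. 1 - (4 * (\<rho> * ln (real n) + 1)\<^sup>2 / (real n - 1) + C * exp (- rate * w n) + g n)
       \<le> measure (graph_process n) {P \<in> space (graph_process n). \<forall>p\<in>{0..1}.
           p \<ge> (\<beta> * (ln (real n) - ln (ln (real n)) / 2) + w n) / (real n - 1) \<longrightarrow>
           real (gp_mindeg n P p) > gp_avgdeg n P p / 2}"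
      using e1 L8 w1 eventually_ge_at_top[of 2] conc
    proof eventually_elim
      case (elim n)
      interpret prob_space "graph_process n" by (rule prob_space_graph_process)
      define L where "L = ln (real n)"
      define x where "x = \<beta> * (L - ln L / 2) + w n"
      have L: "L \<ge> 8" using elim by (auto simp: L_def)
      have "ln L \<le> L" using L ln_le_minus_one[of L] by linarith
      then have "2 * (L / 2) \<le> \<beta> * (L - ln L / 2)" using L \<beta>2 by (intro mult_mono) auto
      then have x: "x - 1 \<ge> L" "x \<ge> 9" using elim L unfolding x_def by linarith+
      \<comment> \<open>\<open>?A\<close> deals with the range up to
        \<open>\<rho> * L / (n - 1)\<close>, \<open>?D\<close> with everything from there on. If
        \<open>w\<close> is so large that \<open>x > \<rho> * L\<close>, then \<open>?A\<close>
        imposes no condition.\<close>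
      let ?A = "{P \<in> space (graph_process n). \<forall>p\<in>{0..1}. x / (real n - 1) \<le> p \<longrightarrow> p \<le> \<rho> * L / (real n - 1) \<longrightarrow>
         real (gp_mindeg n P p) > gp_avgdeg n P p / 2}"
      let ?D = "{P \<in> space (graph_process n). \<forall>p\<in>{0..1}. \<rho> * L / (real n - 1) \<le> p \<longrightarrow>
         real (gp_mindeg n P p) > 1/2 * gp_avgdeg n P p}"
      let ?E = "{P \<in> space (graph_process n). \<forall>p\<in>{0..1}. x / (real n - 1) \<le> p \<longrightarrow>
         real (gp_mindeg n P p) > gp_avgdeg n P p / 2}"
      have A: "prob ?A \<ge> 1 - (4 * (\<rho> * L + 1)\<^sup>2 / (real n - 1) + C * (real n * exp (- rate * x) / sqrt (x - 1)))"
        unfolding C_def using elim L \<rho> x by (intro supercritical_bound) (auto simp: L_def)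
      have D: "prob ?D \<ge> 1 - g n" using elim(5) by (simp add: L_def)
      have "rate * x = (rate * \<beta>) * (L - ln L / 2) + rate * w n" by (simp add: x_def algebra_simps)
      then have "exp (- rate * x) = exp (ln L / 2) / exp L * exp (- rate * w n)"
        by (simp add: \<beta>(3) algebra_simps flip: exp_diff exp_add)
      also have "\<dots> = sqrt L / real n * exp (- rate * w n)"
        using nL[of n] sqL[OF L] elim by (simp add: L_def)
      finally have "real n * exp (- rate * x) / sqrt (x - 1) = sqrt L / sqrt (x - 1) * exp (- rate * w n)"
        using elim by simp
      also have "\<dots> \<le> 1 * exp (- rate * w n)"
        using x L by (intro mult_right_mono) (auto simp: divide_le_eq)
      finally have "real n * exp (- rate * x) / sqrt (x - 1) \<le> exp (- rate * w n)" by simp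
      then have "C * (real n * exp (- rate * x) / sqrt (x - 1)) \<le> C * exp (- rate * w n)"
        using C by (rule mult_left_mono)
      moreover have "prob ?A + prob ?D \<le> 1 + prob ?E"
      proof -
        have Es: "?A \<in> events" "?D \<in> events" "?E \<in> events"
          using gp_range_event_sets(2)[where lo = "x / (real n - 1)" and hi = "\<rho> * L / (real n - 1)" and c = "1/2" and n = n]
            gp_range_event_sets(2)[where lo = "\<rho> * L / (real n - 1)" and hi = 1 and c = "1/2" and n = n]
            gp_range_event_sets(2)[where lo = "x / (real n - 1)" and hi = 1 and c = "1/2" and n = n] by simp_all
        have "space (graph_process n) - ?E \<subseteq> (space (graph_process n) - ?A) \<union> (space (graph_process n) - ?D)"
          by (auto simp: not_less)
        then have "prob (space (graph_process n) - ?E) \<le> prob ((space (graph_process n) - ?A) \<union> (space (graph_process n) - ?D))"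
          using Es by (intro finite_measure_mono) auto
        also have "\<dots> \<le> prob (space (graph_process n) - ?A) + prob (space (graph_process n) - ?D)"
          using Es by (intro measure_Un_le) auto
        finally show ?thesis using Es by (simp add: prob_compl)
      qed
      ultimately show ?case using A D unfolding x_def L_def by linarith
    qed
  qed

  \<comment> \<open>Concentration for every \<open>\<theta>\<close> below 1\<close>
  fix \<theta> :: real assume "0 < \<theta> \<and> \<theta> < 1"
  then obtain \<rho> f where "\<rho> > 0" and f: "f \<longlonglongrightarrow> 0" and ev:
    "eventually (\<lambda>n. measure (graph_process n) {P \<in> space (graph_process n). \<forall>p\<in>{0..1}.
       \<rho> * ln (real n) / (real n - 1) \<le> p \<longrightarrow> real (gp_mindeg n P p) > \<theta> * gp_avgdeg n P p} \<ge> 1 - f n) sequentially"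
    using concentrated_limit[of \<theta>] by auto
  then show "\<exists>\<rho>::real. \<rho> > 0 \<and> ((\<lambda>n. measure (graph_process n)
          {P \<in> space (graph_process n). \<forall>p\<in>{0..1}. \<rho> * ln (real n) / (real n - 1) \<le> p \<longrightarrow>
             real (gp_mindeg n P p) > \<theta> * gp_avgdeg n P p}) \<longlonglongrightarrow> 1)"
    using prob_tendsto_one[OF ev f] by blast
qed

end
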